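(* Let $G$ be an $H$-type group with center $\mathfrak z$ of dimension $m$. The X-ray transform is injective on $L^1(G)$: if $f\in L^1(G)$ and $I_{\nu,\lambda}f=0$ for almost every $(\nu,\lambda)\in S(\mathfrak v^* )\times\mathfrak z^*$, then $f=0$. Moreover, $Z\subset\mathfrak z^*\setminus\{0\}$ is an injectivity set of $I$ if either (i) $Z$ contains a sequence $\{\lambda_i\}$ in $\mathfrak z^*\setminus\{0\}$ accumulating at zero, or (ii) $m>1$ and the set of unit vectors $\hat\mu\in S(\mathfrak z^* )$ whose orthogonal hyperplane $\hat\mu^\perp$ meets $Z$ is dense in $S(\mathfrak z^* )$. This holds, in particular, whenever the set of directions $\{\lambda/|\lambda|:\lambda\in Z\}$ is dense in some great circle of $S(\mathfrak z^* )$.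
   Context: $H$-type group: $\mathfrak g$ is a finite-dimensional real Lie algebra with $[\mathfrak g,[\mathfrak g,\mathfrak g]]=0$ and an inner product $\langle\cdot,\cdot\rangle$; $\mathfrak z\ne0$ is its center, $\mathfrak v\neq 0$ the orthogonal complement of $\mathfrak z$, $m=\dim\mathfrak z$. For $\mu\in\mathfrak z^*$ let $J_\mu:\mathfrak v\to\mathfrak v$ be the skew-adjoint map with $\langle J_\mu V,W\rangle=\mu([V,W])$; one requires $J_\mu^2=-|\mu|^2\mathrm{Id}$ for all $\mu\in\mathfrak z^*$. $G$ is $\mathfrak v\times\mathfrak z$ with product $(x,u)(x',u')=(x+x',u+u'+\tfrac12[x,x'])$ and Haar measure $dx\,du$. The inner product identifies $\mathfrak v^*\cong\mathfrak v$, $\mathfrak z^*\cong\mathfrak z$; $S(\mathfrak v^* ),S(\mathfrak z^* )$ are the unit spheres; $\hat\lambda=\lambda/|\lambda|$. For $\nu\in S(\mathfrak v^* )$, $\lambda\in\mathfrak z^*\setminus\{0\}$ let $\gamma_{\nu,\lambda}(s)=\big(e^{sJ_\lambda}J_\lambda^{-1}\nu,\ \tfrac{s}{2|\lambda|}\hat\lambda\big)\in G$, $s\in\mathbb R$ (the left translates of these curves are exactly the unit-speed sub-Riemannian geodesics of charge $\lambda$). Let $\Gamma_\lambda=\{(0,j\pi|\lambda|^{-2}\hat\lambda):j\in\mathbb Z\}$, $G_\lambda=G/\Gamma_\lambda$ with the induced Haar measure, and for $f\in L^1(G)$ let $I_{\nu,\lambda}f(x,u)=\int_{\mathbb R}f((x,u)\gamma_{\nu,\lambda}(s))\,ds$,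 which is a well-defined element of $L^1(G_\lambda)$. For $f\in L^1(G)$, a set $Z\subset\mathfrak z^*\setminus\{0\}$ is a zero set of $If$ if for every $\lambda\in Z$ there exists $\nu\in S(\mathfrak v^* )$ with $I_{\nu,\lambda}f=0$. $Z$ is an injectivity set of $I$ if the only $f\in L^1(G)$ having $Z$ as a zero set of $If$ is $f=0$. A great circle of $S(\mathfrak z^* )$ is the intersection of $S(\mathfrak z^* )$ with a two-dimensional linear subspace. *)

theory Defs
  imports "HOL-Analysis.Analysis"
begin

text \<open>
  The Lie algebra lives on the orthogonal direct sum \<open>'v \<times> 'z\<close> of two Euclidean spaces; the
  predicate \<open>H_type\<close> demands that its center is exactly the summand \<open>{0} \<times> 'z\<close>, so that
  the orthogonal complement of the center is \<open>'v \<times> {0}\<close>.  Both summands are nonzero because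
  every type of class \<open>euclidean_space\<close> has positive dimension.  The dual spaces of \<open>'v\<close>
  and \<open>'z\<close> are identified with \<open>'v\<close> and \<open>'z\<close> by the inner product.
\<close>

definition lie_bracket :: "('g::real_vector \<Rightarrow> 'g \<Rightarrow> 'g) \<Rightarrow> bool" where
  "lie_bracket br \<longleftrightarrow>
     (\<forall>x. linear (br x)) \<and> (\<forall>y. linear (\<lambda>x. br x y)) \<and>
     (\<forall>x. br x x = 0) \<and>
     (\<forall>x y z. br x (br y z) + br y (br z x) + br z (br x y) = 0)"

definition lie_center :: "('g::real_vector \<Rightarrow> 'g \<Rightarrow> 'g) \<Rightarrow> 'g set" where
  "lie_center br = {c. \<forall>x. br c x = 0}"

text \<open>The bracket of two elements of \<open>'v\<close>, read as an element of \<open>'z\<close>; for a 2-step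
  nilpotent bracket with center \<open>{0} \<times> 'z\<close> the discarded component is zero.\<close>

definition vbracket ::
    "('v::euclidean_space \<times> 'z::euclidean_space \<Rightarrow> 'v \<times> 'z \<Rightarrow> 'v \<times> 'z) \<Rightarrow> 'v \<Rightarrow> 'v \<Rightarrow> 'z" where
  "vbracket br x y = snd (br (x, 0) (y, 0))"

definition J ::
    "('v::euclidean_space \<times> 'z::euclidean_space \<Rightarrow> 'v \<times> 'z \<Rightarrow> 'v \<times> 'z) \<Rightarrow> 'z \<Rightarrow> 'v \<Rightarrow> 'v" where
  "J br \<mu> = (THE A. \<forall>V W. A V \<bullet> W = \<mu> \<bullet> vbracket br V W)"

definition H_type ::
    "('v::euclidean_space \<times> 'z::euclidean_space \<Rightarrow> 'v \<times> 'z \<Rightarrow> 'v \<times> 'z) \<Rightarrow> bool" where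
  "H_type br \<longleftrightarrow>
     lie_bracket br \<and>
     (\<forall>x y z. br x (br y z) = 0) \<and>
     lie_center br = {0} \<times> UNIV \<and>
     (\<forall>\<mu> V. J br \<mu> (J br \<mu> V) = - ((norm \<mu>)\<^sup>2 *\<^sub>R V))"

definition gmult ::
    "('v::euclidean_space \<times> 'z::euclidean_space \<Rightarrow> 'v \<times> 'z \<Rightarrow> 'v \<times> 'z) \<Rightarrow>
       'v \<times> 'z \<Rightarrow> 'v \<times> 'z \<Rightarrow> 'v \<times> 'z" where
  "gmult br g h = (fst g + fst h, snd g + snd h + (1/2) *\<^sub>R vbracket br (fst g) (fst h))"

definition op_exp :: "('v::euclidean_space \<Rightarrow> 'v) \<Rightarrow> 'v \<Rightarrow> 'v" where
  "op_exp A x = (\<Sum>n. (A ^^ n) x /\<^sub>R fact n)"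

text \<open>Here and below, \<open>sgn lam = lam /\<^sub>R norm lam\<close> is the direction of \<open>lam\<close>.\<close>

definition geodesic ::
    "('v::euclidean_space \<times> 'z::euclidean_space \<Rightarrow> 'v \<times> 'z \<Rightarrow> 'v \<times> 'z) \<Rightarrow>
       'v \<Rightarrow> 'z \<Rightarrow> real \<Rightarrow> 'v \<times> 'z" where
  "geodesic br \<nu> lam s =
     (op_exp (\<lambda>x. s *\<^sub>R J br lam x) (inv (J br lam) \<nu>), (s / (2 * norm lam)) *\<^sub>R sgn lam)"

definition Gamma :: "'z::euclidean_space \<Rightarrow> ('v::euclidean_space \<times> 'z) set" where
  "Gamma lam = range (\<lambda>j::int. (0, (of_int j * pi / (norm lam)\<^sup>2) *\<^sub>R sgn lam))"

definition coset ::
    "('v::euclidean_space \<times> 'z::euclidean_space \<Rightarrow> 'v \<times> 'z \<Rightarrow> 'v \<times> 'z) \<Rightarrow> 'z \<Rightarrow>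
       'v \<times> 'z \<Rightarrow> ('v \<times> 'z) set" where
  "coset br lam g = gmult br g ` Gamma lam"

text \<open>
  The Haar measure on the space of cosets of \<open>Gamma lam\<close> that is induced by Lebesgue measure
  (counting measure on the discrete subgroup \<open>Gamma lam\<close>): the image of Lebesgue measure on a
  fundamental domain.  A set of cosets is measurable if its preimage in the group is Borel.
\<close>

definition fund_dom :: "'z::euclidean_space \<Rightarrow> ('v::euclidean_space \<times> 'z) set" where
  "fund_dom lam = {(x, u). 0 \<le> u \<bullet> sgn lam \<and> u \<bullet> sgn lam < pi / (norm lam)\<^sup>2}"

definition quot_measure ::
    "('v::euclidean_space \<times> 'z::euclidean_space \<Rightarrow> 'v \<times> 'z \<Rightarrow> 'v \<times> 'z) \<Rightarrow> 'z \<Rightarrow>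
       ('v \<times> 'z) set measure" where
  "quot_measure br lam =
     distr (restrict_space lborel (fund_dom lam))
       (sigma (range (coset br lam))
          {A. A \<subseteq> range (coset br lam) \<and> coset br lam -` A \<in> sets borel})
       (coset br lam)"

text \<open>The integral over a geodesic depends only on the coset of its base point, because
  translating the base point by an element of \<open>Gamma lam\<close> shifts the parameter; hence it is
  a function on the space of cosets.\<close>

definition xray ::
    "('v::euclidean_space \<times> 'z::euclidean_space \<Rightarrow> 'v \<times> 'z \<Rightarrow> 'v \<times> 'z) \<Rightarrow> 'v \<Rightarrow> 'z \<Rightarrow>
       ('v \<times> 'z \<Rightarrow> complex) \<Rightarrow> ('v \<times> 'z) set \<Rightarrow> complex" where
  "xray br \<nu> lam f C =
     (THE c. \<forall>g\<in>C. (LINT s|lborel. f (gmult br g (geodesic br \<nu> lam s))) = c)"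

text \<open>Vanishing as an element of \<open>L\<^sup>1\<close> of the space of cosets.\<close>

definition xray_zero ::
    "('v::euclidean_space \<times> 'z::euclidean_space \<Rightarrow> 'v \<times> 'z \<Rightarrow> 'v \<times> 'z) \<Rightarrow> 'v \<Rightarrow> 'z \<Rightarrow>
       ('v \<times> 'z \<Rightarrow> complex) \<Rightarrow> bool" where
  "xray_zero br \<nu> lam f \<longleftrightarrow> (AE C in quot_measure br lam. xray br \<nu> lam f C = 0)"

text \<open>Surface measure on the unit sphere, obtained from polar coordinates: the measure of a
  subset of the sphere is the dimension times the volume of the cone over it.\<close>

definition sphere_measure :: "'v::euclidean_space measure" where
  "sphere_measure =
     scale_measure (of_nat DIM('v))
       (distr (restrict_space lborel (ball 0 1 - {0})) (restrict_space borel (sphere 0 1)) sgn)"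

definition zero_set ::
    "('v::euclidean_space \<times> 'z::euclidean_space \<Rightarrow> 'v \<times> 'z \<Rightarrow> 'v \<times> 'z) \<Rightarrow>
       ('v \<times> 'z \<Rightarrow> complex) \<Rightarrow> 'z set \<Rightarrow> bool" where
  "zero_set br f Z \<longleftrightarrow> Z \<subseteq> - {0} \<and> (\<forall>lam\<in>Z. \<exists>\<nu>\<in>sphere 0 1. xray_zero br \<nu> lam f)"

definition injectivity_set ::
    "('v::euclidean_space \<times> 'z::euclidean_space \<Rightarrow> 'v \<times> 'z \<Rightarrow> 'v \<times> 'z) \<Rightarrow> 'z set \<Rightarrow> bool" where
  "injectivity_set br Z \<longleftrightarrow>
     Z \<subseteq> - {0} \<and>
     (\<forall>f. integrable lborel f \<longrightarrow> zero_set br f Z \<longrightarrow> (AE g in lborel. f g = 0))"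

definition great_circle :: "'z::euclidean_space set \<Rightarrow> bool" where
  "great_circle C \<longleftrightarrow> (\<exists>P. subspace P \<and> dim P = 2 \<and> C = sphere 0 1 \<inter> P)"

definition dense_hyperplanes :: "'z::euclidean_space set \<Rightarrow> bool" where
  "dense_hyperplanes Z \<longleftrightarrow>
     sphere 0 1 \<subseteq> closure {\<mu> \<in> sphere 0 1. orthogonal_comp {\<mu>} \<inter> Z \<noteq> {}}"

end

theory Submission
  imports Defs "HOL-Probability.Levy" "HOL-Complex_Analysis.Conformal_Mappings"
begin

text \<open>
  Suppose \<open>I\<^sub>\<nu>\<^sub>,\<^sub>\<lambda> f = 0\<close>. Pairing with a character \<open>\<mu>\<close> of the center that is trivial on the lattice
  \<open>\<Gamma>\<^sub>\<lambda>\<close>, that is \<open>\<mu> \<bullet> \<lambda> / |\<lambda>| = 2 k |\<lambda>|\<^sup>2\<close> with integral \<open>k\<close>, and unfolding the integral over the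
  quotient shows that the partial Fourier transform of \<open>f\<close> at \<open>\<mu>\<close> is annihilated by averages over
  circles of radius \<open>1 / |\<lambda>|\<close> in the plane spanned by \<open>\<nu>\<close> and \<open>J\<^sub>\<lambda> \<nu>\<close>, twisted by \<open>e\<^sup>i\<^sup>k\<^sup>\<theta>\<close> and by the
  cocycle of the group.

  If \<open>\<mu>\<close> is orthogonal to \<open>\<lambda>\<close>, then \<open>k = 0\<close>, the twist can be removed by a unimodular factor, and the
  multiplier of the circle average is a nonzero analytic function; hence the transform of \<open>f\<close> at \<open>\<mu>\<close>
  vanishes. If \<open>\<mu>\<close> is not orthogonal to the limit direction of a sequence \<open>\<lambda>\<^sub>i \<rightarrow> 0\<close>, then \<open>\<mu>\<close> is a limit of
  admissible characters with \<open>k \<rightarrow> \<infinity>\<close>. Testing with \<open>e\<^sup>\<alpha>\<^sup>w cnj w\<^sup>n\<^sup>+\<^sup>k\<close> times a Gaussian of matching width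
  gives polynomials of degree \<open>n\<close> in \<open>cnj w\<close>, whose leading coefficients are the Laguerre values
  \<open>L\<^sub>n\<^sup>(\<^sup>k\<^sup>)(k)\<close>; these are nonzero for large \<open>k\<close>, so all Gaussian moments vanish in the limit, and with
  them the transform of \<open>f\<close> at \<open>\<mu>\<close>. In both cases the set of such \<open>\<mu>\<close> is dense.
\<close>


section \<open>Fourier uniqueness in Euclidean spaces\<close>

lemma integrable_mult_bounded:
  fixes h g :: "'a \<Rightarrow> complex"
  assumes "integrable M h" "g \<in> borel_measurable M" "\<And>x. norm (g x) \<le> C"
  shows "integrable M (\<lambda>x. h x * g x)"
proof (rule Bochner_Integration.integrable_bound)
  show "integrable M (\<lambda>x. C * norm (h x))"
    using assms(1) by simp
  show "(\<lambda>x. h x * g x) \<in> borel_measurable M"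
    using assms by measurable
  have "norm (h x) * norm (g x) \<le> norm (C * norm (h x))" for x
    using mult_left_mono[OF assms(3), of "norm (h x)" x]
    by (metis abs_ge_self mult.commute norm_ge_zero order_trans real_norm_def)
  then show "AE x in M. norm (h x * g x) \<le> norm (C * norm (h x))"
    by (simp add: norm_mult)
qed

lemma integrable_mult_unit:
  fixes h g :: "'a \<Rightarrow> complex"
  assumes "integrable M h" "g \<in> borel_measurable M" "\<And>x. norm (g x) \<le> 1"
  shows "integrable M (\<lambda>x. h x * g x)"
  using assms by (rule integrable_mult_bounded)

lemma borel_measurable_cis [measurable]: "cis \<in> borel_measurable borel"
  by (intro borel_measurable_continuous_onI continuous_intros)

lemma borel_measurable_cnj [measurable]: "cnj \<in> borel_measurable borel"
  by (intro borel_measurable_continuous_onI continuous_intros)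

text \<open>Conjugation reverses the frequency. This supplies the transform of \<open>cnj h\<close>
  for the reduction to real functions and, later, the passage from \<mu> to -\<mu>.\<close>

lemma complex_integral_cnj_eq_0:
  fixes h :: "'a \<Rightarrow> complex"
  assumes "(LINT x|M. h x * cis (- \<phi> x)) = 0"
  shows "(LINT x|M. cnj (h x) * cis (\<phi> x)) = 0"
proof -
  have "(LINT x|M. cnj (h x * cis (- \<phi> x))) = 0"
    by (simp only: Bochner_Integration.integral_cnj assms complex_cnj_zero)
  then show ?thesis by (simp add: cis_cnj)
qed

text \<open>The positive and negative parts of \<open>h\<close>, taken as densities and pushed
  forward by \<phi>, have the same total mass (\<open>t = 0\<close>) and, once normalised, the same
  characteristic function. Levy's uniqueness theorem makes the two image measures equal.\<close>

lemma real_fourier_uniqueness_1d: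
  fixes h \<phi> :: "'a \<Rightarrow> real"
  assumes h: "integrable M h" and [measurable]: "\<phi> \<in> borel_measurable M"
    and F: "\<And>t. (LINT x|M. of_real (h x) * cis (t * \<phi> x)) = 0"
    and A [measurable]: "A \<in> sets borel"
  shows "(LINT x|M. h x * indicator A (\<phi> x)) = 0"
proof -
  note [measurable] = borel_measurable_integrable[OF h]
  define p where "p = (\<lambda>b x. max 0 (if b then h x else - h x))"
  have [measurable]: "p b \<in> borel_measurable M" for b
    unfolding p_def by measurable
  have pint: "integrable M (p b)" for b
    unfolding p_def using h by (cases b) auto
  have p0: "p b x \<ge> 0" for b x by (auto simp: p_def)
  have hp: "h x = p True x - p False x" for x by (auto simp: p_def)
  have pint': "integrable M (\<lambda>x. of_real (p b x) * g x)"
    if "g \<in> borel_measurable M" "\<And>x. norm (g x) \<le> 1" for b and g :: "'a \<Rightarrow> complex"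
    by (rule integrable_mult_unit) (use pint that in auto)
  have cis_int: "integrable M (\<lambda>x. of_real (p b x) * cis (t * \<phi> x))" for b t
    by (rule pint') auto
  have eqF: "(LINT x|M. of_real (p True x) * cis (t * \<phi> x)) = (LINT x|M. of_real (p False x) * cis (t * \<phi> x))" for t
  proof -
    have "(LINT x|M. of_real (p True x) * cis (t * \<phi> x)) - (LINT x|M. of_real (p False x) * cis (t * \<phi> x)) =
      (LINT x|M. of_real (p True x) * cis (t * \<phi> x) - of_real (p False x) * cis (t * \<phi> x))"
      by (rule Bochner_Integration.integral_diff[symmetric]) (rule cis_int)+
    also have "\<dots> = (LINT x|M. of_real (h x) * cis (t * \<phi> x))"
      by (simp add: hp left_diff_distrib)
    finally show ?thesis using F by simp
  qed
  define c where "c = (LINT x|M. p True x)"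
  have c: "(LINT x|M. p b x) = c" for b
    using eqF[of 0] by (cases b) (auto simp: c_def)
  show ?thesis
  \<comment> \<open>The parts cannot be normalised when their common mass \<open>c\<close> is zero;
    then both vanish almost everywhere.\<close>
  proof (cases "c = 0")
    case True
    have "AE x in M. p b x = 0" for b
      using c[of b] True pint p0 integral_nonneg_eq_0_iff_AE[OF pint[of b]] by auto
    then have "AE x in M. h x * indicator A (\<phi> x) = 0"
      using hp by (smt (verit) AE_mp AE_I2 mult_eq_0_iff)
    then have "(LINT x|M. h x * indicator A (\<phi> x)) = (LINT x|M. 0)"
      by (intro integral_cong_AE) auto
    then show ?thesis by simp
  next
    case False
    have "c \<ge> 0" unfolding c_def using p0 by auto
    with False have cp: "c > 0" by simp
    define N where "N b = distr (density M (\<lambda>x. ennreal (p b x / c))) borel \<phi>" for b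
    have sN: "sets (N b) = sets borel" for b by (simp add: N_def)
    have N: "real_distribution (N b)" for b
    proof -
      have "emeasure (density M (\<lambda>x. ennreal (p b x / c))) (space M) = 1"
        using cp pint[of b] p0 c[of b]
        by (simp add: emeasure_density nn_integral_eq_integral cong: nn_integral_cong)
      then have "prob_space (density M (\<lambda>x. ennreal (p b x / c)))"
        by (intro prob_spaceI) simp
      then have "prob_space (N b)"
        unfolding N_def by (intro prob_space.prob_space_distr) auto
      then show ?thesis
        by (simp add: real_distribution_def real_distribution_axioms_def sN)
    qed
    have intN: "(LINT y|N b. g y) = (LINT x|M. (p b x / c) *\<^sub>R g (\<phi> x))"
      if [measurable]: "g \<in> borel_measurable borel" for b and g :: "real \<Rightarrow> 'b::{banach, second_countable_topology}"
      unfolding N_def using cp p0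
      by (subst integral_distr, measurable, subst integral_density, auto)
    have "char (N b) t = (LINT x|M. of_real (p b x) * cis (t * \<phi> x)) / c" for b t
      unfolding char_def
      by (subst intN) (auto simp: scaleR_conv_of_real cis_conv_exp)
    then have "char (N True) = char (N False)"
      using eqF by (auto simp: fun_eq_iff)
    then have eqN: "N True = N False"
      using Levy_uniqueness N by blast
    have "(LINT y|N b. indicator A y :: real) = (LINT x|M. p b x * indicator A (\<phi> x)) / c" for b
      by (subst intN) auto
    from this[of True] this[of False]
    have "(LINT x|M. p True x * indicator A (\<phi> x)) = (LINT x|M. p False x * indicator A (\<phi> x))"
      using cp unfolding eqN by (simp add: field_simps)
    moreover have "integrable M (\<lambda>x. p b x * indicator A (\<phi> x))" for b
      by (rule Bochner_Integration.integrable_bound[OF pint[of b]]) (use p0 in \<open>auto simp: indicator_def\<close>)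
    ultimately show ?thesis
      by (simp add: hp left_diff_distrib)
  qed
qed

text \<open>The hypothesis covers both \<open>t\<close> and \<open>-t\<close>, hence also
  \<open>cnj h\<close>; the sum and the difference of the two transforms are those of the real and
  the imaginary part.\<close>

lemma fourier_uniqueness_1d:
  fixes h :: "'a \<Rightarrow> complex" and \<phi> :: "'a \<Rightarrow> real"
  assumes h: "integrable M h" and [measurable]: "\<phi> \<in> borel_measurable M"
    and F: "\<And>t. (LINT x|M. h x * cis (t * \<phi> x)) = 0"
    and A [measurable]: "A \<in> sets borel"
  shows "(LINT x|M. h x * indicator A (\<phi> x)) = 0"
proof -
  note [measurable] = borel_measurable_integrable[OF h]
  have cnjF: "(LINT x|M. cnj (h x) * cis (t * \<phi> x)) = 0" for t
    by (rule complex_integral_cnj_eq_0) (use F[of "-t"] in simp)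
  have i1: "integrable M (\<lambda>x. h x * cis (t * \<phi> x))" for t
    by (rule integrable_mult_unit) (use h in auto)
  have i2: "integrable M (\<lambda>x. cnj (h x) * cis (t * \<phi> x))" for t
    by (rule integrable_mult_unit) (use h in auto)
  have re: "(LINT x|M. of_real (Re (h x)) * cis (t * \<phi> x)) = 0" for t
  proof -
    have "(LINT x|M. of_real (Re (h x)) * cis (t * \<phi> x)) =
      (LINT x|M. (h x * cis (t * \<phi> x) + cnj (h x) * cis (t * \<phi> x)) / 2)"
      by (intro Bochner_Integration.integral_cong refl) (auto simp: complex_eq_iff algebra_simps)
    also have "\<dots> = 0"
      using Bochner_Integration.integral_add[OF i1[of t] i2[of t]] F[of t] cnjF[of t] by simp
    finally show ?thesis .
  qed
  have im: "(LINT x|M. of_real (Im (h x)) * cis (t * \<phi> x)) = 0" for t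
  proof -
    have "(LINT x|M. of_real (Im (h x)) * cis (t * \<phi> x)) =
      (LINT x|M. (h x * cis (t * \<phi> x) - cnj (h x) * cis (t * \<phi> x)) / (2 * \<i>))"
      by (intro Bochner_Integration.integral_cong refl) (auto simp: complex_eq_iff algebra_simps Re_divide Im_divide)
    also have "\<dots> = 0"
      using Bochner_Integration.integral_diff[OF i1[of t] i2[of t]] F[of t] cnjF[of t] by simp
    finally show ?thesis .
  qed
  have "(LINT x|M. Re (h x) * indicator A (\<phi> x)) = 0"
    using h re A by (intro real_fourier_uniqueness_1d) auto
  moreover have "(LINT x|M. Im (h x) * indicator A (\<phi> x)) = 0"
    using h im A by (intro real_fourier_uniqueness_1d) auto
  moreover have i: "integrable M (\<lambda>x. h x * indicator A (\<phi> x))"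
    by (rule integrable_mult_unit) (use h in \<open>auto simp: indicator_def\<close>)
  moreover have "Re (h x * indicator A (\<phi> x)) = Re (h x) * indicator A (\<phi> x)"
     "Im (h x * indicator A (\<phi> x)) = Im (h x) * indicator A (\<phi> x)" for x
     by (auto simp: indicator_def)
  ultimately show ?thesis
    by (simp add: complex_eq_iff flip: integral_Re integral_Im)
qed

text \<open>One coordinate at a time, the characters in direction \<open>b\<close> are replaced by indicators of
  Borel sets of the coordinate \<open>\<phi> x \<bullet> b\<close>; this reduces the uniqueness theorem to dimension one.\<close>

lemma fourier_uniqueness_Basis:
  fixes h :: "'a \<Rightarrow> complex" and \<phi> :: "'a \<Rightarrow> 'e::euclidean_space"
  assumes h: "integrable M h" and [measurable]: "\<phi> \<in> borel_measurable M"
    and F: "\<And>\<xi>. (LINT x|M. h x * cis (\<xi> \<bullet> \<phi> x)) = 0"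
    and A: "\<And>b. A b \<in> sets borel"
    and B: "finite B" "B \<subseteq> Basis"
  shows "(LINT x|M. h x * (\<Prod>b\<in>B. indicator (A b) (\<phi> x \<bullet> b)) * cis (\<xi> \<bullet> \<phi> x)) = 0"
  using B
proof (induction B arbitrary: \<xi> rule: finite_induct)
  case empty
  then show ?case using F by simp
next
  case (insert c B)
  note [measurable] = borel_measurable_integrable[OF h] A
  let ?h = "\<lambda>x. h x * ((\<Prod>b\<in>B. indicator (A b) (\<phi> x \<bullet> b)) * cis (\<xi> \<bullet> \<phi> x))"
  have "norm (\<Prod>b\<in>B. indicator (A b) (\<phi> x \<bullet> b) :: complex) \<le> 1" for x
    unfolding prod_norm[symmetric] by (rule prod_le_1) (auto simp: indicator_def)
  then have ih: "integrable M ?h"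
    by (intro integrable_mult_unit h) (auto simp: norm_mult)
  \<comment> \<open>A further character in direction \<open>c\<close> only moves \<xi> to
    \<open>\<xi> + t *\<^sub>R c\<close>; this is why \<xi> is arbitrary in the induction.\<close>
  have "(LINT x|M. ?h x * cis (t * (\<phi> x \<bullet> c))) = 0" for t
  proof -
    have "(LINT x|M. ?h x * cis (t * (\<phi> x \<bullet> c))) =
       (LINT x|M. h x * (\<Prod>b\<in>B. indicator (A b) (\<phi> x \<bullet> b)) * cis ((\<xi> + t *\<^sub>R c) \<bullet> \<phi> x))"
      by (intro Bochner_Integration.integral_cong refl)
        (simp add: inner_add_right inner_commute mult_ac flip: cis_mult)
    then show ?thesis using insert by simp
  qed
  from fourier_uniqueness_1d[OF ih _ this A[of c]]
  have "(LINT x|M. ?h x * indicator (A c) (\<phi> x \<bullet> c)) = 0" by simp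
  then show ?case
    using insert by (simp add: mult_ac)
qed

text \<open>The complex measure with density \<open>h\<close>, pushed forward by \<phi>, is zero, so
  every absolutely convergent integral against a function of \<phi> vanishes. \<open>G\<close> may
  be unbounded, which later allows a Gaussian damping to be undone.\<close>

lemma fourier_uniqueness:
  fixes h :: "'a \<Rightarrow> complex" and \<phi> :: "'a \<Rightarrow> 'e::euclidean_space"
  assumes h: "integrable M h" and [measurable]: "\<phi> \<in> borel_measurable M"
    and F: "\<And>\<xi>. (LINT x|M. h x * cis (\<xi> \<bullet> \<phi> x)) = 0"
    and G [measurable]: "G \<in> borel_measurable borel"
    and hG: "integrable M (\<lambda>x. h x * G (\<phi> x))"
  shows "(LINT x|M. h x * G (\<phi> x)) = 0"
proof -
  note [measurable] = borel_measurable_integrable[OF h]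
  have box0: "(LINT x|M. h x * indicator (box a b) (\<phi> x)) = 0" for a b
  proof -
    have "indicator (box a b) y = (\<Prod>c\<in>Basis. indicator {a \<bullet> c<..<b \<bullet> c} (y \<bullet> c) :: complex)" for y
      by (cases "y \<in> box a b") (auto simp: mem_box indicator_def prod_zero_iff)
    with fourier_uniqueness_Basis[OF h assms(2) F, of "\<lambda>c. {a \<bullet> c<..<b \<bullet> c}" Basis 0]
    show ?thesis by simp
  qed
  have real_part: "(LINT x|M. of_real (r (h x)) * G (\<phi> x)) = 0 \<and> integrable M (\<lambda>x. of_real (r (h x)) * G (\<phi> x))"
    if r: "r = Re \<or> r = Im" for r
  proof -
    define p where "p = (\<lambda>b x. max 0 (if b then r (h x) else - r (h x)))"
    have rm [measurable]: "r \<in> borel_measurable borel"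
      using r by auto
    have rb: "\<bar>r z\<bar> \<le> norm z" for z using r abs_Re_le_cmod abs_Im_le_cmod by auto
    have ir: "integrable M (\<lambda>x. r (h x))" using r h by auto
    have [measurable]: "p b \<in> borel_measurable M" for b
      unfolding p_def by measurable
    have p0: "p b x \<ge> 0" for b x by (auto simp: p_def)
    have pb: "p b x \<le> norm (h x)" for b x using rb[of "h x"] by (auto simp: p_def)
    have pint: "integrable M (p b)" for b
      unfolding p_def using ir by (cases b) auto
    have rp: "r (h x) = p True x - p False x" for x by (auto simp: p_def)
    define N where "N b = distr (density M (\<lambda>x. ennreal (p b x))) borel \<phi>" for b
    have em: "emeasure (N b) A = ennreal (LINT x|M. p b x * indicator A (\<phi> x))"
      if [measurable]: "A \<in> sets borel" for b A
    proof -
      have "emeasure (N b) A = (\<integral>\<^sup>+x. ennreal (p b x * indicator A (\<phi> x)) \<partial>M)"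
        unfolding N_def using p0 by (subst emeasure_distr, simp, simp, subst emeasure_density)
           (auto intro!: nn_integral_cong simp: indicator_def)
      also have "\<dots> = ennreal (LINT x|M. p b x * indicator A (\<phi> x))"
        by (rule nn_integral_eq_integral)
          (use p0 in \<open>auto intro!: Bochner_Integration.integrable_bound[OF pint[of b]] simp: indicator_def\<close>)
      finally show ?thesis .
    qed
    have ib: "integrable M (\<lambda>x. p c x * indicator (box a b) (\<phi> x))" for a b c
      by (rule Bochner_Integration.integrable_bound[OF pint[of c]]) (use p0 in \<open>auto simp: indicator_def\<close>)
    have ih: "integrable M (\<lambda>x. h x * indicator (box a b) (\<phi> x))" for a b
      by (rule integrable_mult_unit) (use h in \<open>auto simp: indicator_def\<close>)
    have rbox: "r (h x * indicator (box a b) (\<phi> x)) = r (h x) * indicator (box a b) (\<phi> x)" for a b x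
      using r by (auto simp: indicator_def)
    have "r (LINT x|M. h x * indicator (box a b) (\<phi> x)) =
       (LINT x|M. r (h x) * indicator (box a b) (\<phi> x))" for a b
      unfolding rbox[symmetric]
      using r integral_Re[OF ih, of a b] integral_Im[OF ih, of a b] by (elim disjE) (simp_all only:)
    then have "(LINT x|M. r (h x) * indicator (box a b) (\<phi> x)) = 0" for a b
      using box0 r by auto
    then have "(LINT x|M. p True x * indicator (box a b) (\<phi> x)) = (LINT x|M. p False x * indicator (box a b) (\<phi> x))" for a b
      using Bochner_Integration.integral_diff[OF ib[of True a b] ib[of False a b]]
      by (simp add: rp left_diff_distrib)
    then have emb: "emeasure (N True) (box a b) = emeasure (N False) (box a b)" for a b
      by (simp add: em)
    \<comment> \<open>Boxes form an intersection-stable generator of the Borel sets and exhaust the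
      space with finite measure, so agreement on boxes is enough.\<close>
    have "N True = N False"
    proof (rule measure_eqI_generator_eq[where \<Omega>=UNIV and E="range (\<lambda>(a, b). box a b)" and A="\<lambda>n::nat. box (- real n *\<^sub>R One) (real n *\<^sub>R One)"])
      show "Int_stable (range (\<lambda>(a, b). box a b :: 'e set))"
        by (auto simp: Int_stable_def box_Int_box)
      show "(\<Union>n::nat. box (- real n *\<^sub>R One) (real n *\<^sub>R One)) = (UNIV :: 'e set)"
        using UN_box_eq_UNIV[where 'a='e] by simp
      show "sets (N True) = sigma_sets UNIV (range (\<lambda>(a, b). box a b))"
        "sets (N False) = sigma_sets UNIV (range (\<lambda>(a, b). box a b))"
        by (simp_all add: N_def borel_eq_box)
    qed (use emb in \<open>auto simp: em\<close>)
    moreover have "(LINT y|N b. G y) = (LINT x|M. of_real (p b x) * G (\<phi> x))" for b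
      unfolding N_def using p0
      by (subst integral_distr, measurable, subst integral_density, auto simp: scaleR_conv_of_real)
    moreover have "integrable M (\<lambda>x. of_real (p b x) * G (\<phi> x))" for b
      by (rule Bochner_Integration.integrable_bound[OF hG])
        (use p0 pb in \<open>auto simp: norm_mult intro!: mult_right_mono\<close>)
    ultimately show ?thesis
      by (simp add: rp left_diff_distrib) metis
  qed
  have "h x * G (\<phi> x) = of_real (Re (h x)) * G (\<phi> x) + \<i> * (of_real (Im (h x)) * G (\<phi> x))" for x
    by (simp add: complex_eq_iff)
  then show ?thesis
    using real_part[of Re] real_part[of Im] by simp
qed

text \<open>Testing with \<open>G = cnj (sgn h)\<close> turns the vanishing integral into the L1
  norm of \<open>h\<close>.\<close>

lemma fourier_uniqueness_AE:
  fixes h :: "'e::euclidean_space \<Rightarrow> complex"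
  assumes h: "integrable lborel h"
    and F: "\<And>\<xi>. (LINT x|lborel. h x * cis (\<xi> \<bullet> x)) = 0"
  shows "AE x in lborel. h x = 0"
proof -
  note [measurable] = borel_measurable_integrable[OF h]
  have eq: "h x * cnj (sgn (h x)) = of_real (norm (h x))" for x
    by (cases "h x = 0")
      (auto simp: sgn_eq complex_norm_square[symmetric] power2_eq_square)
  have [measurable]: "(\<lambda>x. cnj (sgn (h x))) \<in> borel_measurable borel"
    unfolding sgn_div_norm by measurable
  have "(LINT x|lborel. h x * cnj (sgn (h x))) = 0"
    using h by (intro fourier_uniqueness[where \<phi>="\<lambda>x. x" and G="\<lambda>x. cnj (sgn (h x))"] F) (auto simp: eq)
  then have "(LINT x|lborel. norm (h x)) = 0"
    unfolding eq by simp
  then show ?thesis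
    using h by (subst (asm) integral_nonneg_eq_0_iff_AE) auto
qed

section \<open>Groups of H-type\<close>

locale h_type_group =
  fixes br :: "'v::euclidean_space \<times> 'z::euclidean_space \<Rightarrow> 'v \<times> 'z \<Rightarrow> 'v \<times> 'z"
  assumes H_type: "H_type br"
begin

lemma vbracket_add_right: "vbracket br x (y + z) = vbracket br x y + vbracket br x z"
  and vbracket_scaleR_right: "vbracket br x (c *\<^sub>R y) = c *\<^sub>R vbracket br x y"
  and vbracket_add_left: "vbracket br (x + y) z = vbracket br x z + vbracket br y z"
  and vbracket_scaleR_left: "vbracket br (c *\<^sub>R x) y = c *\<^sub>R vbracket br x y"
  and vbracket_self: "vbracket br x x = 0"
proof -
  have l: "linear (br p)" "linear (\<lambda>q. br q p)" "br p p = 0" for p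
    using H_type unfolding H_type_def lie_bracket_def by blast+
  have e: "(x + y, 0 :: 'z) = (x, 0) + (y, 0)" "(c *\<^sub>R x, 0 :: 'z) = c *\<^sub>R (x, 0)" for x y :: 'v and c
    by auto
  show "vbracket br x (y + z) = vbracket br x y + vbracket br x z"
    "vbracket br x (c *\<^sub>R y) = c *\<^sub>R vbracket br x y"
    "vbracket br (x + y) z = vbracket br x z + vbracket br y z"
    "vbracket br (c *\<^sub>R x) y = c *\<^sub>R vbracket br x y"
    "vbracket br x x = 0"
    unfolding vbracket_def
    by (simp_all only: e linear_add[OF l(1)] linear_add[OF l(2)] linear_scale[OF l(1)]
        linear_scale[OF l(2)] l(3) snd_add snd_scaleR snd_zero)
qed

lemma linear_vbracket_right: "linear (vbracket br x)"
  by (intro linearI vbracket_add_right vbracket_scaleR_right)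

lemma linear_vbracket_left: "linear (\<lambda>x. vbracket br x y)"
  by (intro linearI vbracket_add_left vbracket_scaleR_left)

lemma vbracket_commute: "vbracket br y x = - vbracket br x y"
proof -
  have "vbracket br (y + x) (y + x) = 0" by (rule vbracket_self)
  then have "vbracket br x y + vbracket br y x = 0"
    by (simp add: vbracket_add_left vbracket_add_right vbracket_self[of x] vbracket_self[of y])
  then show ?thesis
    by (simp only: eq_neg_iff_add_eq_0 add.commute)
qed

text \<open>Expanding \<open>W\<close> in the basis produces a map with this property, and the
  property determines the map; this justifies the definite description in \<open>J\<close>.\<close>

lemma J_inner: "J br \<mu> V \<bullet> W = \<mu> \<bullet> vbracket br V W"
proof -
  have ex: "(\<Sum>b\<in>Basis. (\<mu> \<bullet> vbracket br V b) *\<^sub>R b) \<bullet> W = \<mu> \<bullet> vbracket br V W" for V W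
  proof -
    have "vbracket br V W = vbracket br V (\<Sum>b\<in>Basis. (W \<bullet> b) *\<^sub>R b)"
      by (simp add: euclidean_representation)
    also have "\<dots> = (\<Sum>b\<in>Basis. (W \<bullet> b) *\<^sub>R vbracket br V b)"
      by (simp add: linear_sum[OF linear_vbracket_right] vbracket_scaleR_right)
    finally show ?thesis
      by (simp add: inner_sum_left inner_sum_right inner_commute mult.commute)
  qed
  have "\<exists>!A. \<forall>V W. A V \<bullet> W = \<mu> \<bullet> vbracket br V W"
  proof (rule ex1I[of _ "\<lambda>V. \<Sum>b\<in>Basis. (\<mu> \<bullet> vbracket br V b) *\<^sub>R b"])
    fix A assume "\<forall>V W. A V \<bullet> W = \<mu> \<bullet> vbracket br V W"
    then show "A = (\<lambda>V. \<Sum>b\<in>Basis. (\<mu> \<bullet> vbracket br V b) *\<^sub>R b)"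
      using ex by (intro ext vector_eq_ldot[THEN iffD1]) (simp add: inner_commute)
  qed (use ex in auto)
  from theI'[OF this] show ?thesis
    by (simp add: J_def)
qed

lemma J_eqI: "(\<And>W. J br \<mu> V \<bullet> W = y \<bullet> W) \<Longrightarrow> J br \<mu> V = y"
  by (metis vector_eq_rdot)

lemma J_add: "J br \<mu> (x + y) = J br \<mu> x + J br \<mu> y"
  by (rule J_eqI) (simp add: J_inner inner_add_left inner_add_right vbracket_add_left)

lemma J_scaleR: "J br \<mu> (c *\<^sub>R x) = c *\<^sub>R J br \<mu> x"
  by (rule J_eqI) (simp add: J_inner vbracket_scaleR_left)

lemma linear_J: "linear (J br \<mu>)"
  by (intro linearI J_add J_scaleR)

lemma J_diff: "J br \<mu> (x - y) = J br \<mu> x - J br \<mu> y"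
  by (rule linear_diff[OF linear_J])

lemma J_add_left: "J br (\<mu> + \<mu>') x = J br \<mu> x + J br \<mu>' x"
  by (rule J_eqI) (simp add: J_inner inner_add_left)

lemma J_scaleR_left: "J br (c *\<^sub>R \<mu>) x = c *\<^sub>R J br \<mu> x"
  by (rule J_eqI) (simp add: J_inner)

lemma J_skew: "J br \<mu> V \<bullet> W = - (V \<bullet> J br \<mu> W)"
  by (simp add: J_inner inner_commute[of V] vbracket_commute[of V W])

lemma J_self: "J br \<mu> V \<bullet> V = 0"
  by (simp add: J_inner vbracket_self)

lemma J_J: "J br \<mu> (J br \<mu> V) = - ((norm \<mu>)\<^sup>2 *\<^sub>R V)"
  using H_type by (auto simp: H_type_def)

text \<open>Polarisation in \<mu> of the identity |J V|^2 = |\<mu>|^2 |V|^2, which follows from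
  skewness and the formula for the square of J.\<close>

lemma J_inner_J: "J br \<mu> V \<bullet> J br \<mu>' V = (\<mu> \<bullet> \<mu>') * (V \<bullet> V)"
proof -
  have q: "J br \<mu> V \<bullet> J br \<mu> V = (\<mu> \<bullet> \<mu>) * (V \<bullet> V)" for \<mu>
    by (subst J_skew) (simp add: J_J flip: power2_norm_eq_inner)
  from q[of "\<mu> + \<mu>'"] q[of \<mu>] q[of \<mu>'] show ?thesis
    by (simp add: J_add_left inner_add_left inner_add_right inner_commute algebra_simps)
qed

section \<open>Rotations and explicit geodesics\<close>

text \<open>The square of \<theta> J is -\<theta>^2, so the exponential series splits into the
  cosine series on even powers and the sine series on odd powers.\<close>

lemma op_exp_J:
  assumes "norm \<omega> = 1"
  shows "op_exp (\<lambda>x. \<theta> *\<^sub>R J br \<omega> x) x = cos \<theta> *\<^sub>R x + sin \<theta> *\<^sub>R J br \<omega> x"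
proof -
  let ?A = "\<lambda>x. \<theta> *\<^sub>R J br \<omega> x"
  have sq: "?A (?A y) = - (\<theta>\<^sup>2 *\<^sub>R y)" for y
    using assms by (simp add: J_scaleR J_J power2_eq_square)
  have ev: "(?A ^^ (2 * k)) x = ((-1) ^ k * \<theta> ^ (2 * k)) *\<^sub>R x" for k
  proof (induction k)
    case (Suc k)
    have "(?A ^^ (2 * Suc k)) x = ?A (?A ((?A ^^ (2 * k)) x))" by simp
    also have "\<dots> = - (\<theta>\<^sup>2 *\<^sub>R ((-1) ^ k * \<theta> ^ (2 * k)) *\<^sub>R x)" by (simp only: sq Suc.IH)
    finally show ?case by (simp add: power2_eq_square mult_ac)
  qed auto
  have "(?A ^^ n) x /\<^sub>R fact n =
      (cos_coeff n *\<^sub>R \<theta> ^ n) *\<^sub>R x + (sin_coeff n *\<^sub>R \<theta> ^ n) *\<^sub>R J br \<omega> x" for n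
  proof (cases "even n")
    case True
    then obtain k where "n = 2 * k" by blast
    then show ?thesis using ev[of k] by (simp add: cos_coeff_def sin_coeff_def divide_inverse mult_ac)
  next
    case False
    then obtain k where "n = Suc (2 * k)" using oddE by fastforce
    then show ?thesis using ev[of k]
      by (simp add: cos_coeff_def sin_coeff_def divide_inverse mult_ac J_scaleR)
  qed
  moreover have "(\<lambda>n. (cos_coeff n *\<^sub>R \<theta> ^ n) *\<^sub>R x + (sin_coeff n *\<^sub>R \<theta> ^ n) *\<^sub>R J br \<omega> x) sums
      (cos \<theta> *\<^sub>R x + sin \<theta> *\<^sub>R J br \<omega> x)"
    by (intro sums_add sums_scaleR_left cos_converges sin_converges)
  ultimately show ?thesis
    unfolding op_exp_def by (simp add: sums_unique[symmetric])
qed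

text \<open>For the unit vector \<omega> = \<open>sgn lam\<close> the map
  \<open>J br \<omega>\<close> squares to -1, so the inverse of \<open>J br lam\<close> is -1/|lam|
  times \<open>J br \<omega>\<close>. For unit \<nu> the horizontal part is thus a circle of radius
  1/|lam| traversed with angular speed |lam|.\<close>

lemma geodesic_eq:
  assumes "lam \<noteq> 0"
  shows "geodesic br \<nu> lam s =
    ((1 / norm lam) *\<^sub>R (sin (s * norm lam) *\<^sub>R \<nu> - cos (s * norm lam) *\<^sub>R J br (sgn lam) \<nu>),
     (s / (2 * norm lam)) *\<^sub>R sgn lam)"
proof -
  define \<omega> where "\<omega> = sgn lam"
  have \<omega>: "norm \<omega> = 1" and lam: "lam = norm lam *\<^sub>R \<omega>"
    using assms by (auto simp: \<omega>_def norm_sgn sgn_div_norm)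
  have J: "J br lam x = norm lam *\<^sub>R J br \<omega> x" for x
    by (subst lam) (rule J_scaleR_left)
  have JJ: "J br \<omega> (J br \<omega> x) = - x" for x
    using \<omega> by (simp add: J_J)
  have Jn: "J br \<mu> (- x) = - J br \<mu> x" for \<mu> x
    by (rule linear_neg[OF linear_J])
  have "inj (J br lam)"
    by (rule inj_on_inverseI[of _ "\<lambda>x. (- 1 / norm lam) *\<^sub>R J br \<omega> x"])
      (use assms in \<open>simp add: J J_scaleR JJ\<close>)
  then have inv: "inv (J br lam) \<nu> = (- 1 / norm lam) *\<^sub>R J br \<omega> \<nu>"
    by (rule inv_f_eq) (use assms in \<open>simp add: J J_scaleR Jn JJ\<close>)
  have "op_exp (\<lambda>x. s *\<^sub>R J br lam x) y = cos (s * norm lam) *\<^sub>R y + sin (s * norm lam) *\<^sub>R J br \<omega> y" for y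
    using op_exp_J[OF \<omega>, of "s * norm lam" y] by (simp add: J)
  then show ?thesis
    by (simp add: geodesic_def inv J_scaleR Jn JJ scaleR_diff_right flip: \<omega>_def)
qed

text \<open>Coordinates on the plane of a geodesic, which is spanned by \<open>\<nu>\<close> and \<open>J\<^sub>\<omega> \<nu>\<close>.\<close>

definition plane_coord :: "'v \<Rightarrow> 'z \<Rightarrow> 'v \<Rightarrow> complex" where
  "plane_coord \<nu> \<omega> x = Complex (x \<bullet> \<nu>) (x \<bullet> J br \<omega> \<nu>)"

definition plane_vec :: "'v \<Rightarrow> 'z \<Rightarrow> complex \<Rightarrow> 'v" where
  "plane_vec \<nu> \<omega> w = Re w *\<^sub>R \<nu> + Im w *\<^sub>R J br \<omega> \<nu>"

abbreviation plane_proj :: "'v \<Rightarrow> 'z \<Rightarrow> 'v \<Rightarrow> 'v" where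
  "plane_proj \<nu> \<omega> x \<equiv> plane_vec \<nu> \<omega> (plane_coord \<nu> \<omega> x)"

lemma plane_coord_diff: "plane_coord \<nu> \<omega> (x - y) = plane_coord \<nu> \<omega> x - plane_coord \<nu> \<omega> y"
  by (simp add: plane_coord_def complex_eq_iff inner_diff_left)

lemma plane_vec_diff: "plane_vec \<nu> \<omega> (w - z) = plane_vec \<nu> \<omega> w - plane_vec \<nu> \<omega> z"
  by (simp add: plane_vec_def algebra_simps)

context
  fixes \<nu> :: 'v and \<omega> :: 'z
  assumes unit: "norm \<nu> = 1" "norm \<omega> = 1"
begin

lemma plane_frame:
  "\<nu> \<bullet> \<nu> = 1" "J br \<omega> \<nu> \<bullet> J br \<omega> \<nu> = 1" "J br \<omega> \<nu> \<bullet> \<nu> = 0" "\<nu> \<bullet> J br \<omega> \<nu> = 0"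
  using unit J_self[of \<omega> \<nu>] by (simp_all add: J_inner_J inner_commute norm_eq_1)

lemma plane_coord_plane_vec: "plane_coord \<nu> \<omega> (plane_vec \<nu> \<omega> w) = w"
  by (simp add: plane_coord_def plane_vec_def complex_eq_iff inner_add_left plane_frame)

lemma plane_vec_inner: "plane_vec \<nu> \<omega> w \<bullet> x = Re w * Re (plane_coord \<nu> \<omega> x) + Im w * Im (plane_coord \<nu> \<omega> x)"
  by (simp add: plane_coord_def plane_vec_def inner_add_left inner_commute[of x])

text \<open>Between vectors of the plane, the form of \<open>J br \<mu>\<close> sees only the
  component of \<mu> along \<omega>, and \<open>Im (cnj w * z)\<close> is the area form in the
  complex coordinate.\<close>

lemma J_plane_vec_inner:
  "J br \<mu> (plane_vec \<nu> \<omega> w) \<bullet> plane_vec \<nu> \<omega> z = (\<mu> \<bullet> \<omega>) * Im (cnj w * z)"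
proof -
  have a: "J br \<mu> \<nu> \<bullet> J br \<omega> \<nu> = \<mu> \<bullet> \<omega>"
    by (simp add: J_inner_J plane_frame)
  have b: "J br \<mu> (J br \<omega> \<nu>) \<bullet> \<nu> = - (\<mu> \<bullet> \<omega>)"
    by (subst J_skew) (simp add: inner_commute a)
  show ?thesis
    by (simp add: plane_vec_def J_add J_scaleR inner_add_left inner_add_right a b J_self algebra_simps)
qed

text \<open>The two terms pairing \<open>J br \<mu> x\<close> with the shift cancel, and the
  remaining correction pairs vectors of the plane only. Hence the group cocycle becomes a twist that
  depends on \<open>x\<close> through its plane coordinate alone.\<close>

lemma J_plane_shift:
  "J br \<mu> (x - plane_vec \<nu> \<omega> W) \<bullet> plane_proj \<nu> \<omega> (x - plane_vec \<nu> \<omega> W) + J br \<mu> x \<bullet> plane_vec \<nu> \<omega> W =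
   J br \<mu> x \<bullet> plane_proj \<nu> \<omega> x + (\<mu> \<bullet> \<omega>) * Im (cnj (plane_coord \<nu> \<omega> x) * W)"
  by (simp add: plane_coord_diff plane_coord_plane_vec plane_vec_diff J_diff inner_diff_left
      inner_diff_right J_plane_vec_inner algebra_simps)

lemma plane_complement_shift:
  "(x - plane_vec \<nu> \<omega> W) - plane_proj \<nu> \<omega> (x - plane_vec \<nu> \<omega> W) = x - plane_proj \<nu> \<omega> x"
  by (simp add: plane_coord_diff plane_coord_plane_vec plane_vec_diff)

end

end

section \<open>Shears and unfolding of periodic integrals\<close>

text \<open>Fubini and translation invariance, first in each fibre and then in the base. Right
  translations of the group have this form.\<close>

lemma distr_shear:
  fixes a :: "'a::euclidean_space" and L :: "'a \<Rightarrow> 'b::euclidean_space"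
  assumes [measurable]: "L \<in> borel_measurable borel"
  shows "distr lborel borel (\<lambda>(x, y). (x + a, y + L x)) = lborel"
proof (rule measure_eqI)
  fix A :: "('a \<times> 'b) set"
  assume "A \<in> sets (distr lborel borel (\<lambda>(x, y). (x + a, y + L x)))"
  then have [measurable]: "A \<in> sets borel" by simp
  then have A': "A \<in> sets (borel \<Otimes>\<^sub>M borel)" by (simp only: borel_prod)
  have [measurable]: "(\<lambda>(x, y). (x + a, y + L x)) \<in> borel_measurable (borel :: ('a \<times> 'b) measure)"
    unfolding borel_prod[symmetric] by measurable
  have "emeasure (distr lborel borel (\<lambda>(x, y). (x + a, y + L x))) A =
      (\<integral>\<^sup>+p. indicator A (fst p + a, snd p + L (fst p)) \<partial>lborel)"
    by (subst nn_integral_indicator[symmetric], simp, subst nn_integral_distr)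
      (simp_all add: case_prod_beta)
  also have "\<dots> = (\<integral>\<^sup>+x. \<integral>\<^sup>+y. indicator A (x + a, y + L x) \<partial>lborel \<partial>lborel)"
    unfolding lborel_prod[symmetric]
    by (subst lborel.nn_integral_fst[symmetric]) (use A' in \<open>simp_all add: measurable_split_conv\<close>)
  also have "\<dots> = (\<integral>\<^sup>+x. \<integral>\<^sup>+y. indicator A (x + a, y) \<partial>lborel \<partial>lborel)"
  proof (rule nn_integral_cong)
    fix x
    have "(\<integral>\<^sup>+y. indicator A (x + a, y) \<partial>(lborel :: 'b measure)) =
       (\<integral>\<^sup>+y. indicator A (x + a, y) \<partial>(distr lborel borel ((+) (L x))))"
      by (simp add: lborel_distr_plus)
    also have "\<dots> = (\<integral>\<^sup>+y. indicator A (x + a, y + L x) \<partial>lborel)"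
      by (subst nn_integral_distr) (use A' in \<open>simp_all add: add.commute\<close>)
    finally show "(\<integral>\<^sup>+y. indicator A (x + a, y + L x) \<partial>lborel) = (\<integral>\<^sup>+y. indicator A (x + a, y) \<partial>lborel)" ..
  qed
  also have "\<dots> = (\<integral>\<^sup>+x. \<integral>\<^sup>+y. indicator A (x, y) \<partial>lborel \<partial>(distr lborel borel ((+) a)))"
    by (subst nn_integral_distr) (use A' in \<open>simp_all add: add.commute\<close>)
  also have "\<dots> = emeasure (lborel \<Otimes>\<^sub>M lborel) A"
    by (subst lborel.emeasure_pair_measure) (use A' in \<open>simp_all add: lborel_distr_plus\<close>)
  finally show "emeasure (distr lborel borel (\<lambda>(x, y). (x + a, y + L x))) A = emeasure lborel A"
    by (simp add: lborel_prod)
qed simp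

text \<open>Fubini again; it will be applied to right translation by the point of a geodesic at a
  varying parameter.\<close>

lemma distr_fibrewise:
  fixes T :: "'b::euclidean_space \<Rightarrow> 'a::euclidean_space \<Rightarrow> 'a"
  assumes T: "\<And>s. distr lborel borel (T s) = lborel"
    and [measurable]: "(\<lambda>(p, s). T s p) \<in> borel_measurable borel"
  shows "distr lborel borel (\<lambda>(p, s). (T s p, s)) = lborel"
proof (rule measure_eqI)
  fix A :: "('a \<times> 'b) set"
  assume "A \<in> sets (distr lborel borel (\<lambda>(p, s). (T s p, s)))"
  then have [measurable]: "A \<in> sets borel" by simp
  then have A': "A \<in> sets (borel \<Otimes>\<^sub>M borel)" by (simp only: borel_prod)
  have m': "(\<lambda>(p, s). T s p) \<in> measurable (borel \<Otimes>\<^sub>M borel) borel"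
    by (simp only: borel_prod assms(2))
  have [measurable]: "(\<lambda>(p, s). (T s p, s)) \<in> borel_measurable borel"
    using m' unfolding borel_prod[symmetric] by (simp add: measurable_split_conv)
  have Ts [measurable]: "T s \<in> borel_measurable borel" for s
  proof -
    have "(\<lambda>p. (\<lambda>(p, s). T s p) (p, s)) \<in> borel_measurable borel"
      by (rule measurable_compose[OF _ m']) measurable
    then show ?thesis by simp
  qed
  have "emeasure (distr lborel borel (\<lambda>(p, s). (T s p, s))) A =
      (\<integral>\<^sup>+q. indicator A (T (snd q) (fst q), snd q) \<partial>lborel)"
    by (subst nn_integral_indicator[symmetric], simp, subst nn_integral_distr)
      (simp_all add: case_prod_beta)
  also have "\<dots> = (\<integral>\<^sup>+s. \<integral>\<^sup>+p. indicator A (T s p, s) \<partial>lborel \<partial>lborel)"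
    unfolding lborel_prod[symmetric]
    by (subst lborel_pair.nn_integral_snd[symmetric]) (use A' m' in \<open>simp_all add: measurable_split_conv\<close>)
  also have "\<dots> = (\<integral>\<^sup>+s. \<integral>\<^sup>+p. indicator A (p, s) \<partial>lborel \<partial>lborel)"
  proof (rule nn_integral_cong)
    fix s
    have "(\<integral>\<^sup>+p. indicator A (p, s) \<partial>lborel) = (\<integral>\<^sup>+p. indicator A (p, s) \<partial>(distr lborel borel (T s)))"
      by (simp add: T)
    also have "\<dots> = (\<integral>\<^sup>+p. indicator A (T s p, s) \<partial>lborel)"
      by (subst nn_integral_distr) (use A' in simp_all)
    finally show "(\<integral>\<^sup>+p. indicator A (T s p, s) \<partial>lborel) = (\<integral>\<^sup>+p. indicator A (p, s) \<partial>lborel)" ..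
  qed
  also have "\<dots> = (\<integral>\<^sup>+q. indicator A q \<partial>lborel)"
    unfolding lborel_prod[symmetric]
    by (subst lborel_pair.nn_integral_snd[symmetric]) (use A' in \<open>simp_all\<close>)
  finally show "emeasure (distr lborel borel (\<lambda>(p, s). (T s p, s))) A = emeasure lborel A"
    by simp
qed simp

text \<open>The set where \<open>0 \<le> b < 1\<close> need not be an interval, but it contains exactly one point of each
  coset of \<open>2\<pi>\<int>\<close>.\<close>

lemma distr_unfold_period:
  fixes b :: "real \<Rightarrow> real"
  assumes [measurable]: "b \<in> borel_measurable borel" and b: "\<And>\<theta>. b (\<theta> + 2 * pi) = b \<theta> - 1"
  defines "per \<equiv> \<lambda>\<theta>. \<theta> - 2 * pi * of_int \<lfloor>\<theta> / (2 * pi)\<rfloor>"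
  shows "distr (density lborel (indicator {\<theta>. 0 \<le> b \<theta> \<and> b \<theta> < 1})) borel per = density lborel (indicator {0..<2 * pi})"
proof (rule measure_eqI)
  have bj: "b (\<theta> + 2 * pi * of_int j) = b \<theta> - of_int j" for \<theta> j
  proof (induction j rule: int_induct[where k=0])
    case (step1 i)
    then show ?case using b[of "\<theta> + 2 * pi * of_int i"] by (simp add: algebra_simps)
  next
    case (step2 i)
    then show ?case using b[of "\<theta> + 2 * pi * of_int (i - 1)"] by (simp add: algebra_simps)
  qed auto
  have [measurable]: "per \<in> borel_measurable borel" unfolding per_def by measurable
  let ?D = "distr (density lborel (indicator {\<theta>. 0 \<le> b \<theta> \<and> b \<theta> < 1})) borel per"
  fix A assume "A \<in> sets ?D"
  then have [measurable]: "A \<in> sets borel" by simp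
  \<comment> \<open>\<open>X j\<close> collects the points lying in period number \<open>j\<close>,
    and \<open>Y j\<close> the base points that must be moved by \<open>j\<close> periods to bring
    \<open>b\<close> into [0,1). Translation by 2 pi j carries \<open>Y j\<close> onto
    \<open>X j\<close>.\<close>
  define X where "X j = {\<theta>. 0 \<le> b \<theta> \<and> b \<theta> < 1 \<and> per \<theta> \<in> A \<and> \<lfloor>\<theta> / (2 * pi)\<rfloor> = j}" for j :: int
  define Y where "Y j = {\<theta>. 0 \<le> \<theta> \<and> \<theta> < 2 * pi \<and> \<theta> \<in> A \<and> \<lfloor>b \<theta>\<rfloor> = j}" for j :: int
  have [measurable]: "X j \<in> sets borel" "Y j \<in> sets borel" for j
    unfolding X_def Y_def by measurable
  have fl: "\<lfloor>\<theta> / (2 * pi) + of_int j\<rfloor> = j \<longleftrightarrow> 0 \<le> \<theta> \<and> \<theta> < 2 * pi" for \<theta> j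
    by (simp add: floor_eq_iff field_simps)
  have XY: "\<theta> + 2 * pi * of_int j \<in> X j \<longleftrightarrow> \<theta> \<in> Y j" for \<theta> j
  proof -
    have d: "(\<theta> + 2 * pi * of_int j) / (2 * pi) = \<theta> / (2 * pi) + of_int j"
      by (simp add: field_simps)
    show ?thesis
    proof (cases "0 \<le> \<theta> \<and> \<theta> < 2 * pi")
      case True
      then have "\<lfloor>\<theta> / (2 * pi)\<rfloor> = 0" using fl[of \<theta> 0] by simp
      then have "per (\<theta> + 2 * pi * of_int j) = \<theta>" unfolding per_def d by simp
      then show ?thesis
        using True fl[of \<theta> j] unfolding X_def Y_def mem_Collect_eq d bj
        by (auto simp: floor_eq_iff)
    next
      case False
      then show ?thesis
        using fl[of \<theta> j] by (auto simp: X_def Y_def d)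
    qed
  qed
  have "emeasure lborel (X j) = emeasure lborel (Y j)" for j
  proof -
    have "emeasure lborel (X j) = emeasure (distr lborel borel ((+) (2 * pi * of_int j))) (X j)"
      by (simp add: lborel_distr_plus)
    also have "\<dots> = emeasure lborel ((+) (2 * pi * of_int j) -` X j \<inter> space lborel)"
      by (subst emeasure_distr) simp_all
    also have "(+) (2 * pi * of_int j) -` X j \<inter> space lborel = Y j"
      using XY by (auto simp: add.commute)
    finally show ?thesis .
  qed
  moreover have "emeasure lborel (\<Union>(range X)) = (\<integral>\<^sup>+j. emeasure lborel (X j) \<partial>count_space UNIV)"
    by (rule emeasure_UN_countable) (auto simp: disjoint_family_on_def X_def)
  moreover have "emeasure lborel (\<Union>(range Y)) = (\<integral>\<^sup>+j. emeasure lborel (Y j) \<partial>count_space UNIV)"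
    by (rule emeasure_UN_countable) (auto simp: disjoint_family_on_def Y_def)
  ultimately have "emeasure lborel (\<Union>(range X)) = emeasure lborel (\<Union>(range Y))"
    by simp
  moreover have "\<Union>(range X) = {\<theta>. 0 \<le> b \<theta> \<and> b \<theta> < 1} \<inter> per -` A" by (auto simp: X_def)
  moreover have "\<Union>(range Y) = {0..<2 * pi} \<inter> A" by (auto simp: Y_def)
  moreover have "emeasure (density lborel (indicator S)) B = emeasure lborel (S \<inter> B)"
    if [measurable]: "S \<in> sets borel" "B \<in> sets borel" for S B :: "real set"
    by (simp add: emeasure_density flip: indicator_inter_arith)
  moreover have "per -` A \<in> sets borel"
    using measurable_sets_borel[of per borel A] by simp
  ultimately show "emeasure ?D A = emeasure (density lborel (indicator {0..<2 * pi})) A"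
    by (simp add: emeasure_distr)
qed simp

text \<open>In the application \<open>b\<close> is a central coordinate measured in periods of the
  lattice, and the condition on \<open>b\<close> describes the fundamental domain. The second claim
  yields absolute convergence of the unfolded integral.\<close>

lemma integral_unfold_period:
  fixes b :: "real \<Rightarrow> real" and h :: "real \<Rightarrow> complex"
  assumes [measurable]: "b \<in> borel_measurable borel" "h \<in> borel_measurable borel"
    and b: "\<And>\<theta>. b (\<theta> + 2 * pi) = b \<theta> - 1" and h: "\<And>\<theta>. h (\<theta> + 2 * pi) = h \<theta>"
  shows "(LINT \<theta>|lborel. indicator {\<theta>. 0 \<le> b \<theta> \<and> b \<theta> < 1} \<theta> * h \<theta>) = (LINT \<theta>:{0..2*pi}|lborel. h \<theta>)"
    and "(\<integral>\<^sup>+\<theta>. indicator {\<theta>. 0 \<le> b \<theta> \<and> b \<theta> < 1} \<theta> \<partial>lborel) = ennreal (2 * pi)"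
proof -
  define per where "per = (\<lambda>\<theta>::real. \<theta> - 2 * pi * of_int \<lfloor>\<theta> / (2 * pi)\<rfloor>)"
  have [measurable]: "per \<in> borel_measurable borel" unfolding per_def by measurable
  have hj: "h (\<theta> + 2 * pi * of_int j) = h \<theta>" for \<theta> j
  proof (induction j rule: int_induct[where k=0])
    case (step1 i)
    then show ?case using h[of "\<theta> + 2 * pi * of_int i"] by (simp add: algebra_simps)
  next
    case (step2 i)
    then show ?case using h[of "\<theta> + 2 * pi * of_int (i - 1)"] by (simp add: algebra_simps)
  qed auto
  have hper: "h (per \<theta>) = h \<theta>" for \<theta>
    unfolding per_def using hj[of "per \<theta>" "\<lfloor>\<theta> / (2 * pi)\<rfloor>"] by (simp add: per_def)
  let ?S = "{\<theta>. 0 \<le> b \<theta> \<and> b \<theta> < 1}"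
  have eq: "distr (density lborel (indicator ?S)) borel per = density lborel (indicator {0..<2 * pi})"
    unfolding per_def by (rule distr_unfold_period) (use b in auto)
  have ind: "(indicator S :: real \<Rightarrow> ennreal) = (\<lambda>x. ennreal (indicator S x))" for S
    by (auto simp: indicator_def)
  have dens: "(LINT \<theta>|density lborel (indicator S). h \<theta>) = (LINT \<theta>:S|lborel. h \<theta>)"
    if [measurable]: "S \<in> sets borel" for S
    unfolding ind by (subst integral_density) (auto simp: set_lebesgue_integral_def)
  have "(LINT \<theta>|lborel. indicator ?S \<theta> * h \<theta>) = (LINT \<theta>:?S|lborel. h \<theta>)"
    unfolding set_lebesgue_integral_def
    by (intro Bochner_Integration.integral_cong) (auto simp: indicator_def)
  also have "\<dots> = (LINT \<theta>|density lborel (indicator ?S). h (per \<theta>))"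
    by (simp add: dens hper)
  also have "\<dots> = (LINT \<theta>|density lborel (indicator {0..<2*pi}). h \<theta>)"
    unfolding eq[symmetric] by (subst integral_distr) auto
  also have "\<dots> = (LINT \<theta>:{0..<2*pi}|lborel. h \<theta>)"
    by (simp add: dens)
  also have "\<dots> = (LINT \<theta>:{0..2*pi}|lborel. h \<theta>)"
    by (rule set_integral_cong_set)
      (auto simp: set_borel_measurable_def intro!: AE_I'[of "{2*pi}"])
  finally show "(LINT \<theta>|lborel. indicator ?S \<theta> * h \<theta>) = (LINT \<theta>:{0..2*pi}|lborel. h \<theta>)" .
  have "(\<integral>\<^sup>+\<theta>. indicator ?S \<theta> \<partial>lborel) = emeasure (distr (density lborel (indicator ?S)) borel per) UNIV"
    by (subst emeasure_distr) (auto simp: emeasure_density)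
  also have "\<dots> = ennreal (2 * pi)"
    unfolding eq by (simp add: emeasure_density)
  finally show "(\<integral>\<^sup>+\<theta>. indicator ?S \<theta> \<partial>lborel) = ennreal (2 * pi)" .
qed

section \<open>Pairing the X-ray transform with characters\<close>

lemma borel_measurable_fst [measurable]:
    "(fst :: 'a::second_countable_topology \<times> 'b::second_countable_topology \<Rightarrow> 'a) \<in> borel_measurable borel"
  and borel_measurable_snd [measurable]:
    "(snd :: 'a::second_countable_topology \<times> 'b::second_countable_topology \<Rightarrow> 'b) \<in> borel_measurable borel"
  by (intro borel_measurable_continuous_onI continuous_intros)+

context h_type_group
begin

section \<open>Continuity of the group operations and the integral over a coset\<close>

lemma bounded_bilinear_vbracket: "bounded_bilinear (vbracket br)"
  unfolding bilinear_conv_bounded_bilinear[symmetric] bilinear_def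
  by (intro conjI allI linear_vbracket_left linear_vbracket_right)

lemmas continuous_on_vbracket [continuous_intros] =
  bounded_bilinear.continuous_on[OF bounded_bilinear_vbracket]

lemma continuous_on_J [continuous_intros]:
  "continuous_on S g \<Longrightarrow> continuous_on S (\<lambda>x. J br \<mu> (g x))"
  by (rule continuous_on_compose2[OF linear_continuous_on[OF linear_conv_bounded_linear[THEN iffD1, OF linear_J]] _ subset_UNIV])

lemma continuous_on_plane_vec [continuous_intros]:
  "continuous_on S g \<Longrightarrow> continuous_on S (\<lambda>x. plane_vec \<nu> \<omega> (g x))"
  unfolding plane_vec_def by (intro continuous_intros)

lemma continuous_on_plane_coord [continuous_intros]:
  "continuous_on S g \<Longrightarrow> continuous_on S (\<lambda>x. plane_coord \<nu> \<omega> (g x))"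
  unfolding plane_coord_def complex_eq_cancel_iff2 Complex_eq by (intro continuous_intros)

lemma geodesic_eq_plane_vec:
  assumes "lam \<noteq> 0"
  shows "geodesic br \<nu> lam (\<theta> / norm lam) =
    (plane_vec \<nu> (sgn lam) (- \<i> * cis \<theta> / norm lam), (\<theta> / (2 * (norm lam)\<^sup>2)) *\<^sub>R sgn lam)"
  using assms
  by (simp add: geodesic_eq plane_vec_def scaleR_diff_right power2_eq_square divide_simps)

lemma xray_coset:
  assumes "lam \<noteq> 0"
  shows "xray br \<nu> lam f (coset br lam g) =
    (LINT s|lborel. f (gmult br g (geodesic br \<nu> lam s)))"
proof -
  \<comment> \<open>After the parameter length 2 pi / |lam| the circle closes up while the central
    coordinate has advanced by pi / |lam|^2, the generator of the lattice.\<close>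
  have shift: "gmult br (gmult br g (0, (of_int j * pi / (norm lam)\<^sup>2) *\<^sub>R sgn lam)) (geodesic br \<nu> lam s) =
    gmult br g (geodesic br \<nu> lam (of_int j * (2 * pi / norm lam) + s))" for j s
  proof -
    have "(of_int j * (2 * pi / norm lam) + s) * norm lam = s * norm lam + 2 * pi * of_int j"
      using assms by (simp add: field_simps)
    moreover have "(of_int j * (2 * pi / norm lam) + s) / (2 * norm lam) =
        of_int j * pi / (norm lam)\<^sup>2 + s / (2 * norm lam)"
      using assms by (simp add: field_simps power2_eq_square)
    moreover have "vbracket br x 0 = 0" for x
      using linear_0[OF linear_vbracket_right] .
    moreover have "cos (t + 2 * pi * of_int j) = cos t" "sin (t + 2 * pi * of_int j) = sin t" for t
      by (simp_all add: cos_add sin_add)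
    ultimately show ?thesis
      by (simp only: geodesic_eq[OF assms]) (simp add: gmult_def scaleR_add_left add_ac)
  qed
  have all: "(LINT s|lborel. f (gmult br g' (geodesic br \<nu> lam s))) = (LINT s|lborel. f (gmult br g (geodesic br \<nu> lam s)))"
    if g': "g' \<in> coset br lam g" for g'
  proof -
    from g' obtain j where "g' = gmult br g (0, (of_int j * pi / (norm lam)\<^sup>2) *\<^sub>R sgn lam)"
      by (auto simp: coset_def Gamma_def)
    then show ?thesis
      using lborel_integral_real_affine[of 1 "\<lambda>s. f (gmult br g (geodesic br \<nu> lam s))" "of_int j * (2 * pi / norm lam)"]
      by (simp add: shift)
  qed
  have "gmult br g (0, (of_int 0 * pi / (norm lam)\<^sup>2) *\<^sub>R sgn lam) \<in> coset br lam g"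
    unfolding coset_def Gamma_def by (intro imageI rangeI)
  with all show ?thesis
    unfolding xray_def by (intro the_equality) auto
qed

text \<open>The quotient measure is the image of Lebesgue measure on the fundamental domain, so the
  exceptional null set pulls back. Rescaling replaces arc length by the angle of rotation.\<close>

lemma AE_geodesic_integral_eq_0:
  assumes lam: "lam \<noteq> 0" and z: "xray_zero br \<nu> lam f"
  shows "AE g in lborel. g \<in> fund_dom lam \<longrightarrow>
    (LINT \<theta>|lborel. f (gmult br g (geodesic br \<nu> lam (\<theta> / norm lam)))) = 0"
proof -
  have [measurable]: "fund_dom lam \<in> sets (borel :: ('v \<times> 'z) measure)"
    unfolding fund_dom_def case_prod_beta by measurable
  have "coset br lam \<in> measurable (restrict_space lborel (fund_dom lam))
    (sigma (range (coset br lam)) {A. A \<subseteq> range (coset br lam) \<and> coset br lam -` A \<in> sets borel})"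
    by (rule measurable_measure_of) (auto simp: sets_restrict_space space_restrict_space)
  from AE_distrD[OF this z[unfolded xray_zero_def quot_measure_def]]
  have "AE g in lborel. g \<in> fund_dom lam \<longrightarrow> (LINT s|lborel. f (gmult br g (geodesic br \<nu> lam s))) = 0"
    by (simp add: xray_coset[OF lam] AE_restrict_space_iff)
  then show ?thesis
  proof eventually_elim
    case (elim g)
    then show ?case
      using lborel_integral_real_affine[of "1 / norm lam" "\<lambda>s. f (gmult br g (geodesic br \<nu> lam s))" 0] lam
      by auto
  qed
qed

text \<open>The test function \<open>\<phi>(x) e\<^sup>-\<^sup>i\<^sup>\<mu>\<^sup>u\<close> descends to the quotient by \<open>Gamma lam\<close> exactly if
  \<open>\<mu> \<bullet> sgn lam\<close> is an integral multiple of \<open>2 |lam|\<^sup>2\<close>.\<close>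

lemma xray_pairing:
  assumes \<nu>: "norm \<nu> = 1" and lam: "lam \<noteq> 0" and f: "integrable lborel f" and z: "xray_zero br \<nu> lam f"
    and \<mu>: "\<mu> \<bullet> sgn lam = 2 * real k * (norm lam)\<^sup>2"
    and [measurable]: "\<phi> \<in> borel_measurable borel" and C: "\<And>x. norm (\<phi> x) \<le> C"
  defines "r \<equiv> \<lambda>\<theta>. plane_vec \<nu> (sgn lam) (- \<i> * cis \<theta> / norm lam)"
  shows "(LINT g|lborel. f g * (LINT \<theta>:{0..2*pi}|lborel.
     \<phi> (fst g - r \<theta>) * cis (- (\<mu> \<bullet> snd g) + real k * \<theta> + (J br \<mu> (fst g) \<bullet> r \<theta>) / 2))) = 0"
proof -
  define \<omega> where "\<omega> = sgn lam"
  have \<omega>: "\<omega> \<bullet> \<omega> = 1" using lam by (simp add: \<omega>_def norm_sgn norm_eq_1[symmetric])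
  define geo where "geo \<theta> = geodesic br \<nu> lam (\<theta> / norm lam)" for \<theta>
  have geo: "geo \<theta> = (r \<theta>, (\<theta> / (2 * (norm lam)\<^sup>2)) *\<^sub>R \<omega>)" for \<theta>
    unfolding geo_def geodesic_eq_plane_vec[OF lam] r_def \<omega>_def ..
  have r_cont [continuous_intros]: "continuous_on S t \<Longrightarrow> continuous_on S (\<lambda>x. r (t x))" for S and t :: "'x::topological_space \<Rightarrow> real"
    unfolding r_def using lam by (intro continuous_intros) auto
  have r_per: "r (\<theta> + 2 * pi) = r \<theta>" for \<theta>
    by (simp add: r_def cis_mult[symmetric])
  \<comment> \<open>\<open>T\<close> recovers the base point from a point of the translated geodesic
    and its parameter.\<close>
  define T where "T = (\<lambda>q::('v \<times> 'z) \<times> real. (fst (fst q) - r (snd q),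
      snd (fst q) - (snd q / (2 * (norm lam)\<^sup>2)) *\<^sub>R \<omega> - (1/2) *\<^sub>R vbracket br (fst (fst q)) (r (snd q))))"
  have T_cont [continuous_intros]: "continuous_on S T" for S
    unfolding T_def using lam by (intro continuous_intros) auto
  have [measurable]: "T \<in> borel_measurable borel"
    by (intro borel_measurable_continuous_onI continuous_intros)
  have T_geo: "T (gmult br g (geo \<theta>), \<theta>) = g" for g \<theta>
    by (simp add: T_def gmult_def geo vbracket_add_left vbracket_self prod_eq_iff)
  define S where "S = (\<lambda>(g, \<theta>). (gmult br g (geo \<theta>), \<theta>))"
  have "continuous_on UNIV (\<lambda>(g, \<theta>). gmult br g (geo \<theta>))"
    unfolding gmult_def geo case_prod_beta using lam
    by (simp, intro continuous_intros) auto
  then have gm: "(\<lambda>(g, \<theta>). gmult br g (geo \<theta>)) \<in> borel_measurable borel"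
    by (rule borel_measurable_continuous_onI)
  have "continuous_on UNIV S"
    unfolding S_def gmult_def geo case_prod_beta using lam
    by (simp, intro continuous_intros) auto
  then have [measurable]: "S \<in> borel_measurable borel"
    by (rule borel_measurable_continuous_onI)
  \<comment> \<open>For fixed \<theta>, right translation by \<open>geo \<theta>\<close> is a shear,
    so \<open>S\<close> preserves Lebesgue measure.\<close>
  have distr_S: "distr lborel borel S = lborel"
    unfolding S_def
  proof (rule distr_fibrewise[OF _ gm])
    fix \<theta>
    have "(\<lambda>g. gmult br g (geo \<theta>)) =
        (\<lambda>(x, y). (x + r \<theta>, y + ((\<theta> / (2 * (norm lam)\<^sup>2)) *\<^sub>R \<omega> + (1/2) *\<^sub>R vbracket br x (r \<theta>))))"
      by (auto simp: gmult_def geo add_ac)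
    moreover have "(\<lambda>x. (\<theta> / (2 * (norm lam)\<^sup>2)) *\<^sub>R \<omega> + (1/2) *\<^sub>R vbracket br x (r \<theta>)) \<in> borel_measurable borel"
      by (intro borel_measurable_continuous_onI continuous_intros)
    ultimately show "distr lborel borel (\<lambda>g. gmult br g (geo \<theta>)) = lborel"
      using distr_shear by simp
  qed
  define \<Phi> where "\<Phi> = (\<lambda>g::'v \<times> 'z. \<phi> (fst g) * cis (- (\<mu> \<bullet> snd g)))"
  have [measurable]: "(\<lambda>g::'v \<times> 'z. cis (- (\<mu> \<bullet> snd g))) \<in> borel_measurable borel"
    by (intro borel_measurable_continuous_onI continuous_intros)
  have [measurable]: "\<Phi> \<in> borel_measurable borel"
    unfolding \<Phi>_def by measurable
  have \<Phi>C: "norm (\<Phi> g) \<le> C" for g using C by (simp add: \<Phi>_def norm_mult)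
  have C0: "C \<ge> 0" using C[of 0] norm_ge_zero order_trans by blast
  \<comment> \<open>The position of the base point relative to the fundamental domain, whose width
    is scaled to 1; a full turn of \<theta> lowers it by exactly 1.\<close>
  define b where "b g \<theta> = (snd (T (g, \<theta>)) \<bullet> \<omega>) * (norm lam)\<^sup>2 / pi" for g \<theta>
  have b_per: "b g (\<theta> + 2 * pi) = b g \<theta> - 1" for g \<theta>
  proof -
    have "snd (T (g, \<theta> + 2 * pi)) = snd (T (g, \<theta>)) - (pi / (norm lam)\<^sup>2) *\<^sub>R \<omega>"
      by (simp add: T_def r_per add_divide_distrib scaleR_add_left)
    then show ?thesis
      using lam by (simp add: b_def inner_diff_left \<omega> left_diff_distrib diff_divide_distrib)
  qed
  have b_meas: "b g \<in> borel_measurable borel" for g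
    unfolding b_def by (intro borel_measurable_continuous_onI continuous_intros continuous_on_compose2[OF T_cont[of UNIV]]) auto
  have fund: "T (g, \<theta>) \<in> fund_dom lam \<longleftrightarrow> 0 \<le> b g \<theta> \<and> b g \<theta> < 1" for g \<theta>
    using lam pi_gt_zero unfolding not_le[symmetric] by (auto simp: fund_dom_def b_def case_prod_beta field_simps \<omega>_def[symmetric] zero_le_mult_iff zero_le_divide_iff)
  have \<Phi>T: "\<Phi> (T (g, \<theta>)) = \<phi> (fst g - r \<theta>) * cis (- (\<mu> \<bullet> snd g) + real k * \<theta> + (J br \<mu> (fst g) \<bullet> r \<theta>) / 2)" for g \<theta>
  proof -
    have "- (\<mu> \<bullet> snd (T (g, \<theta>))) = - (\<mu> \<bullet> snd g) + real k * \<theta> + (J br \<mu> (fst g) \<bullet> r \<theta>) / 2"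
    proof -
      have "\<theta> / (2 * (norm lam)\<^sup>2) * (\<mu> \<bullet> \<omega>) = real k * \<theta>"
        using \<mu> lam by (simp add: \<omega>_def field_simps)
      then show ?thesis
        by (simp add: T_def inner_diff_right J_inner)
    qed
    then show ?thesis by (simp only: \<Phi>_def) (simp add: T_def)
  qed
  \<comment> \<open>Integrality of \<open>k\<close> enters here: the phase grows by a multiple of 2
    pi in each turn.\<close>
  have \<Phi>T_per: "\<Phi> (T (g, \<theta> + 2 * pi)) = \<Phi> (T (g, \<theta>))" for g \<theta>
  proof -
    have "cis (a + real k * (\<theta> + 2 * pi) + c) = cis (a + real k * \<theta> + c)" for a c
    proof -
      have "cis (a + real k * (\<theta> + 2 * pi) + c) = cis (a + real k * \<theta> + c) * cis (2 * pi * real k)"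
        by (simp add: cis_mult algebra_simps)
      then show ?thesis by (simp add: cis_multiple_2pi)
    qed
    then show ?thesis by (simp only: \<Phi>T r_per)
  qed
  have \<Phi>T_meas: "(\<lambda>\<theta>. \<Phi> (T (g, \<theta>))) \<in> borel_measurable borel" for g
    by measurable
  have [measurable]: "fund_dom lam \<in> sets (borel :: ('v \<times> 'z) measure)"
    unfolding fund_dom_def case_prod_beta by measurable
  have [measurable]: "f \<in> borel_measurable borel"
    using borel_measurable_integrable[OF f] by simp
  have [measurable]: "(\<lambda>\<theta>. T (g, \<theta>)) \<in> borel_measurable borel" for g
    by measurable
  have indT_meas: "(\<lambda>\<theta>. indicator (fund_dom lam) (T (g, \<theta>)) :: ennreal) \<in> borel_measurable borel" for g
    by (rule measurable_compose[of "\<lambda>\<theta>. T (g, \<theta>)" borel borel]) simp_all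
  have [measurable]: "(\<lambda>q. indicator (fund_dom lam) (T q) :: complex) \<in> borel_measurable borel"
    "(\<lambda>q. indicator (fund_dom lam) (T q) :: ennreal) \<in> borel_measurable borel"
    by (rule measurable_compose[of T borel borel], simp_all)+
  define H where "H = (\<lambda>q. f (fst q) * (indicator (fund_dom lam) (T q) * \<Phi> (T q)))"
  have [measurable]: "H \<in> borel_measurable borel"
    unfolding H_def by measurable
  have ind: "indicator (fund_dom lam) (T (g, \<theta>)) = (indicator {\<theta>. 0 \<le> b g \<theta> \<and> b g \<theta> < 1} \<theta> :: complex)" for g \<theta>
    by (simp add: fund indicator_def)
  \<comment> \<open>For fixed \<open>g\<close> the parameters that put the base point into the
    fundamental domain have total length 2 pi, so the norm is at most 2 pi \<open>C\<close> times
    that of \<open>f\<close>.\<close>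
  have intH: "integrable lborel H"
  proof (rule integrableI_bounded)
    have "(\<integral>\<^sup>+q. ennreal (norm (H q)) \<partial>lborel) \<le>
        (\<integral>\<^sup>+q. ennreal (C * norm (f (fst q))) * indicator (fund_dom lam) (T q) \<partial>lborel)"
    proof (rule nn_integral_mono)
      fix q
      have "norm (f (fst q)) * norm (\<Phi> (T q)) \<le> norm (f (fst q)) * C"
        by (intro mult_left_mono \<Phi>C) auto
      then show "ennreal (norm (H q)) \<le> ennreal (C * norm (f (fst q))) * indicator (fund_dom lam) (T q)"
        by (cases "T q \<in> fund_dom lam") (auto simp: H_def norm_mult mult.commute[of C] intro!: ennreal_leI)
    qed
    also have "\<dots> = (\<integral>\<^sup>+g. \<integral>\<^sup>+\<theta>. ennreal (C * norm (f g)) * indicator (fund_dom lam) (T (g, \<theta>)) \<partial>lborel \<partial>lborel)"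
      unfolding lborel_prod[symmetric]
      by (subst lborel.nn_integral_fst[symmetric]) (simp_all add: lborel_prod)
    also have "\<dots> = (\<integral>\<^sup>+g. ennreal (C * norm (f g)) * ennreal (2 * pi) \<partial>lborel)"
    proof (rule nn_integral_cong)
      fix g
      have "(\<integral>\<^sup>+\<theta>. indicator (fund_dom lam) (T (g, \<theta>)) \<partial>lborel) = ennreal (2 * pi)"
        using integral_unfold_period(2)[OF b_meas \<Phi>T_meas b_per \<Phi>T_per, of g]
        by (simp add: fund indicator_def)
      then show "(\<integral>\<^sup>+\<theta>. ennreal (C * norm (f g)) * indicator (fund_dom lam) (T (g, \<theta>)) \<partial>lborel) =
          ennreal (C * norm (f g)) * ennreal (2 * pi)"
        by (subst nn_integral_cmult) (auto simp del: borel_measurable_indicator_iff intro!: indT_meas)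
    qed
    also have "\<dots> < \<infinity>"
    proof -
      have "integrable lborel (\<lambda>g. C * norm (f g))" using f by simp
      then have "(\<integral>\<^sup>+g. ennreal (C * norm (f g)) \<partial>lborel) < \<infinity>"
        using C0 by (subst nn_integral_eq_integral) auto
      then show ?thesis
        by (subst nn_integral_multc) (auto simp: ennreal_mult_less_top)
    qed
    finally show "(\<integral>\<^sup>+q. ennreal (norm (H q)) \<partial>lborel) < \<infinity>" .
  qed simp
  have HS: "H (S (g, \<theta>)) = indicator (fund_dom lam) g * \<Phi> g * f (gmult br g (geo \<theta>))" for g \<theta>
    by (simp add: H_def S_def T_geo)
  have intHS: "integrable lborel (\<lambda>q. H (S q))"
    using intH by (subst (asm) distr_S[symmetric], subst (asm) integrable_distr_eq) auto
  \<comment> \<open>One period in \<theta> is traded for all \<theta> with base point in the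
    fundamental domain. The substitution \<open>S\<close> then makes the base point the outer
    variable, and the inner integral becomes the X-ray transform.\<close>
  have "(LINT g|lborel. f g * (LINT \<theta>:{0..2*pi}|lborel. \<Phi> (T (g, \<theta>)))) =
      (LINT g|lborel. LINT \<theta>|lborel. H (g, \<theta>))"
    using integral_unfold_period(1)[OF b_meas \<Phi>T_meas b_per \<Phi>T_per]
    by (simp add: H_def ind)
  also have "\<dots> = (LINT q|lborel. H q)"
    using lborel_pair.integral_fst'[of H] intH by (simp add: lborel_prod)
  also have "\<dots> = (LINT q|lborel. H (S q))"
    by (subst distr_S[symmetric], subst integral_distr) auto
  also have "\<dots> = (LINT g|lborel. LINT \<theta>|lborel. H (S (g, \<theta>)))"
    using lborel_pair.integral_fst'[of "\<lambda>q. H (S q)"] intHS by (simp add: lborel_prod)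
  also have "\<dots> = (LINT g|lborel. indicator (fund_dom lam) g * \<Phi> g * (LINT \<theta>|lborel. f (gmult br g (geo \<theta>))))"
    unfolding HS by simp
  also have "\<dots> = 0"
  proof (rule integral_eq_zero_AE)
    show "AE g in lborel. indicator (fund_dom lam) g * \<Phi> g * (LINT \<theta>|lborel. f (gmult br g (geo \<theta>))) = 0"
      using AE_geodesic_integral_eq_0[OF lam z] unfolding geo_def
      by eventually_elim (auto simp: indicator_def)
  qed
  finally show ?thesis by (simp only: \<Phi>T)
qed

text \<open>The factor \<open>cis (J\<^sub>\<mu> y \<bullet> P y / 2)\<close> in the test function cancels the part of the phase
  \<open>J\<^sub>\<mu> x \<bullet> r / 2\<close> that depends on the component of \<open>x\<close> orthogonal to the plane of the geodesic.\<close>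

lemma plane_pairing:
  fixes \<psi> :: "complex \<Rightarrow> complex"
  assumes \<nu>: "norm \<nu> = 1" and lam: "lam \<noteq> 0" and f: "integrable lborel f" and z: "xray_zero br \<nu> lam f"
    and \<mu>: "\<mu> \<bullet> sgn lam = 2 * real k * (norm lam)\<^sup>2"
    and [measurable]: "\<psi> \<in> borel_measurable borel" and C: "\<And>w. norm (\<psi> w) \<le> C"
  defines "W \<equiv> \<lambda>\<theta>. - \<i> * cis \<theta> / norm lam"
    and "w \<equiv> plane_coord \<nu> (sgn lam)" and "P \<equiv> plane_proj \<nu> (sgn lam)"
  shows "(LINT g|lborel. f g * cis (- (\<mu> \<bullet> snd g) + (J br \<mu> (fst g) \<bullet> P (fst g)) / 2 + \<xi> \<bullet> (fst g - P (fst g))) *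
     (LINT \<theta>:{0..2*pi}|lborel. \<psi> (w (fst g) - W \<theta>) *
        cis (real k * \<theta> + real k * (norm lam)\<^sup>2 * Im (cnj (w (fst g)) * W \<theta>)))) = 0"
proof -
  have \<omega>: "norm (sgn lam) = 1" using lam by (simp add: norm_sgn)
  \<comment> \<open>The component \<open>y - P y\<close> is invariant under translation in the
    plane, so a character \<xi> of it can be carried along unchanged.\<close>
  define \<phi> where "\<phi> y = cis ((J br \<mu> y \<bullet> P y) / 2 + \<xi> \<bullet> (y - P y)) * \<psi> (w y)" for y
  have [measurable]: "(\<lambda>y. cis ((J br \<mu> y \<bullet> P y) / 2 + \<xi> \<bullet> (y - P y))) \<in> borel_measurable borel"
    unfolding P_def by (intro borel_measurable_continuous_onI continuous_intros) auto
  have [measurable]: "w \<in> borel_measurable borel"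
    unfolding w_def by (intro borel_measurable_continuous_onI continuous_intros)
  have [measurable]: "\<phi> \<in> borel_measurable borel"
    unfolding \<phi>_def by measurable
  have "\<phi> (x - plane_vec \<nu> (sgn lam) (W \<theta>)) * cis (- (\<mu> \<bullet> u) + real k * \<theta> + (J br \<mu> x \<bullet> plane_vec \<nu> (sgn lam) (W \<theta>)) / 2) =
      cis (- (\<mu> \<bullet> u) + (J br \<mu> x \<bullet> P x) / 2 + \<xi> \<bullet> (x - P x)) *
      (\<psi> (w x - W \<theta>) * cis (real k * \<theta> + real k * (norm lam)\<^sup>2 * Im (cnj (w x) * W \<theta>)))" for x u \<theta>
  proof -
    let ?y = "x - plane_vec \<nu> (sgn lam) (W \<theta>)"
    have "w ?y = w x - W \<theta>"
      by (simp add: w_def plane_coord_diff plane_coord_plane_vec[OF \<nu> \<omega>])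
    moreover have "?y - P ?y = x - P x"
      unfolding P_def by (rule plane_complement_shift[OF \<nu> \<omega>])
    moreover have "J br \<mu> ?y \<bullet> P ?y / 2 + (J br \<mu> x \<bullet> plane_vec \<nu> (sgn lam) (W \<theta>)) / 2 =
        (J br \<mu> x \<bullet> P x) / 2 + real k * (norm lam)\<^sup>2 * Im (cnj (w x) * W \<theta>)"
      using J_plane_shift[OF \<nu> \<omega>, of \<mu> x "W \<theta>"] unfolding \<mu> P_def w_def by (simp add: field_simps)
    moreover have "cis (A + s) * p * cis (m + n + B) = cis (m + C + s) * (p * cis (n + D))"
      if "A + B = C + D" for A B C D s m n p
    proof -
      have "A = C + D - B" using that by simp
      then show ?thesis by (simp add: mult_ac add_ac cis_mult)
    qed
    ultimately show ?thesis
      unfolding \<phi>_def by metis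
  qed
  then have "(LINT \<theta>:{0..2*pi}|lborel. \<phi> (x - plane_vec \<nu> (sgn lam) (W \<theta>)) *
       cis (- (\<mu> \<bullet> u) + real k * \<theta> + (J br \<mu> x \<bullet> plane_vec \<nu> (sgn lam) (W \<theta>)) / 2)) =
      cis (- (\<mu> \<bullet> u) + (J br \<mu> x \<bullet> P x) / 2 + \<xi> \<bullet> (x - P x)) *
      (LINT \<theta>:{0..2*pi}|lborel. \<psi> (w x - W \<theta>) * cis (real k * \<theta> + real k * (norm lam)\<^sup>2 * Im (cnj (w x) * W \<theta>)))" for x u
    by simp
  with xray_pairing[OF \<nu> lam f z \<mu>, of \<phi> C] C show ?thesis
    by (simp add: \<phi>_def norm_mult W_def mult.assoc)
qed

text \<open>The integral is, up to scaling, the Bessel function of order zero.\<close>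

lemma integral_inner_circle_nonzero:
  fixes \<eta> :: complex
  assumes "open U" "(t0::real) \<in> U"
  shows "\<exists>t\<in>U. (LINT \<theta>:{0..2*pi}|lborel. cis (t * (\<eta> \<bullet> (- \<i> * cis \<theta> / of_real a)))) \<noteq> 0"
proof (rule ccontr)
  assume "\<not> ?thesis"
  then have zero: "(LINT \<theta>:{0..2*pi}|lborel. cis (t * (\<eta> \<bullet> (- \<i> * cis \<theta> / of_real a)))) = 0" if "t \<in> U" for t
    using that by blast
  define q where "q \<theta> = complex_of_real (\<eta> \<bullet> (- \<i> * cis \<theta> / of_real a))" for \<theta> :: real
  have q [continuous_intros]: "continuous_on S g \<Longrightarrow> continuous_on S (\<lambda>x. q (g x))" for S :: "'x::topological_space set" and g
    unfolding q_def divide_inverse by (intro continuous_intros)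
  \<comment> \<open>The entire extension to complex \<open>t\<close>. Vanishing on a nonempty open
    set of reals would make it zero everywhere, although its value at 0 is 2 pi.\<close>
  define F where "F z = integral (cbox 0 (2 * pi)) (\<lambda>\<theta>. exp (\<i> * z * q \<theta>))" for z
  have F: "F holomorphic_on UNIV"
    unfolding F_def
  proof (rule leibniz_rule_holomorphic[where fx = "\<lambda>z \<theta>. \<i> * q \<theta> * exp (\<i> * z * q \<theta>)"])
    show "((\<lambda>z. exp (\<i> * z * q t)) has_field_derivative \<i> * q t * exp (\<i> * z * q t)) (at z within UNIV)" for z t
      by (auto intro!: derivative_eq_intros)
    show "(\<lambda>\<theta>. exp (\<i> * z * q \<theta>)) integrable_on cbox 0 (2 * pi)" for z
      by (intro integrable_continuous continuous_intros)
    show "continuous_on (UNIV \<times> cbox 0 (2 * pi)) (\<lambda>(z, t). \<i> * q t * exp (\<i> * z * q t))"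
      unfolding case_prod_beta by (intro continuous_intros)
  qed simp
  have F_real: "F (of_real t) = (LINT \<theta>:{0..2*pi}|lborel. cis (t * (\<eta> \<bullet> (- \<i> * cis \<theta> / of_real a))))" for t
  proof -
    have "set_integrable lborel {0..2*pi} (\<lambda>\<theta>. exp (\<i> * of_real t * q \<theta>))"
      by (intro borel_integrable_atLeastAtMost' continuous_intros)
    from set_borel_integral_eq_integral(2)[OF this] show ?thesis
      by (simp add: F_def cis_conv_exp q_def mult.assoc)
  qed
  have "F 0 = 0"
  proof (rule analytic_continuation[OF F, of "of_real ` U" "of_real t0"])
    show "complex_of_real t0 islimpt complex_of_real ` U"
    proof -
      have "t0 islimpt U" using assms by (simp add: interior_limit_point interior_open)
      then obtain X where X: "\<And>n::nat. X n \<in> U - {t0}" "X \<longlonglongrightarrow> t0"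
        unfolding islimpt_sequential by auto
      then show ?thesis
        unfolding islimpt_sequential
        by (intro exI[of _ "\<lambda>n. complex_of_real (X n)"]) (auto intro!: tendsto_intros)
    qed
    show "F z = 0" if "z \<in> complex_of_real ` U" for z
      using that zero F_real by auto
  qed auto
  moreover have "F 0 = 2 * pi" by (simp add: F_def scaleR_conv_of_real)
  ultimately show False by simp
qed

section \<open>Characters orthogonal to \<open>lam\<close>\<close>

lemma continuous_fourier:
  fixes h :: "'a \<Rightarrow> complex" and p :: "'a \<Rightarrow> 'e::euclidean_space"
  assumes h: "integrable M h" and [measurable]: "p \<in> borel_measurable M"
    and X: "X \<longlonglongrightarrow> x"
  shows "(\<lambda>n. LINT g|M. h g * cis (X n \<bullet> p g)) \<longlonglongrightarrow> (LINT g|M. h g * cis (x \<bullet> p g))"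
proof (rule integral_dominated_convergence[where w="\<lambda>g. norm (h g)"])
  note [measurable] = borel_measurable_integrable[OF h]
  show "AE g in M. (\<lambda>n. h g * cis (X n \<bullet> p g)) \<longlonglongrightarrow> h g * cis (x \<bullet> p g)"
    using X by (intro AE_I2 tendsto_intros)
  show "(\<lambda>g. h g * cis (x \<bullet> p g)) \<in> borel_measurable M" by measurable
  show "\<And>n. (\<lambda>g. h g * cis (X n \<bullet> p g)) \<in> borel_measurable M" by measurable
qed (use h in \<open>auto simp: norm_mult\<close>)

text \<open>Here \<open>k = 0\<close>, so plane characters are eigenfunctions of the circle average.
  The horizontal transform \<open>A\<close> of the phase-twisted function, multiplied by a Bessel
  factor, vanishes, and this factor is zero on no nonempty open set.\<close>

lemma fourier_eq_0_if_orthogonal: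
  assumes \<nu>: "norm \<nu> = 1" and lam: "lam \<noteq> 0" and f: "integrable lborel f" and z: "xray_zero br \<nu> lam f"
    and \<mu>: "\<mu> \<bullet> lam = 0"
  shows "(LINT g|lborel. f g * cis (\<xi> \<bullet> fst g - \<mu> \<bullet> snd g)) = 0"
proof -
  define w where "w = plane_coord \<nu> (sgn lam)"
  define P where "P x = plane_proj \<nu> (sgn lam) x" for x
  have \<omega>: "norm (sgn lam) = 1" using lam by (simp add: norm_sgn)
  define h where "h g = f g * cis (- (\<mu> \<bullet> snd g) + (J br \<mu> (fst g) \<bullet> P (fst g)) / 2)" for g
  have mc: "(\<lambda>g. cis (- (\<mu> \<bullet> snd g) + (J br \<mu> (fst g) \<bullet> P (fst g)) / 2)) \<in> borel_measurable borel"
    unfolding P_def by (intro borel_measurable_continuous_onI continuous_intros) auto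
  have h: "integrable lborel h"
    unfolding h_def by (rule integrable_mult_unit[OF f]) (use mc in auto)
  define A where "A \<xi> = (LINT g|lborel. h g * cis (\<xi> \<bullet> fst g))" for \<xi>
  have A0: "A \<xi> = 0" for \<xi>
  proof (rule ccontr)
    assume ne: "A \<xi> \<noteq> 0"
    have prod0: "A (t *\<^sub>R \<xi>) * (LINT \<theta>:{0..2*pi}|lborel. cis (t * (- w \<xi> \<bullet> (- \<i> * cis \<theta> / of_real (norm lam))))) = 0" for t
    proof -
      have [measurable]: "(\<lambda>v. cis (t * (w \<xi> \<bullet> v))) \<in> borel_measurable borel"
        by (intro borel_measurable_continuous_onI continuous_intros)
      have \<mu>': "\<mu> \<bullet> sgn lam = 2 * real 0 * (norm lam)\<^sup>2"
        using \<mu> by (simp add: sgn_div_norm)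
      note pair = plane_pairing[OF \<nu> lam f z \<mu>', of "\<lambda>v. cis (t * (w \<xi> \<bullet> v))" 1 "t *\<^sub>R \<xi>", folded P_def, folded w_def]
      have split: "f g * cis (- (\<mu> \<bullet> snd g) + (J br \<mu> (fst g) \<bullet> P (fst g)) / 2 + t *\<^sub>R \<xi> \<bullet> (fst g - P (fst g))) *
          (LINT \<theta>:{0..2*pi}|lborel. cis (t * (w \<xi> \<bullet> (w (fst g) - (- \<i> * cis \<theta> / of_real (norm lam))))) *
           cis (real 0 * \<theta> + real 0 * (norm lam)\<^sup>2 * Im (cnj (w (fst g)) * (- \<i> * cis \<theta> / of_real (norm lam))))) =
          h g * cis (t *\<^sub>R \<xi> \<bullet> fst g) *
          (LINT \<theta>:{0..2*pi}|lborel. cis (t * (- w \<xi> \<bullet> (- \<i> * cis \<theta> / of_real (norm lam)))))" for g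
      proof -
        have 1: "cis (t * (w \<xi> \<bullet> (w x - v))) * cis (real 0 * \<theta> + real 0 * (norm lam)\<^sup>2 * Im (cnj (w x) * v)) =
          cis (t * (w \<xi> \<bullet> w x)) * cis (t * (- w \<xi> \<bullet> v))" for x v \<theta>
          by (simp add: inner_diff_right right_diff_distrib cis_mult)
        have 2: "P x \<bullet> \<xi> = w \<xi> \<bullet> w x" for x
          unfolding P_def w_def plane_vec_inner[OF \<nu> \<omega>] by (simp add: inner_complex_def mult.commute)
        have 3: "cis (c + t *\<^sub>R \<xi> \<bullet> (x - P x)) * cis (t * (w \<xi> \<bullet> w x)) = cis c * cis (t *\<^sub>R \<xi> \<bullet> x)" for c x
          unfolding cis_mult 2[symmetric] by (simp add: inner_diff_right inner_commute algebra_simps)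
        show ?thesis
          unfolding 1 unfolding h_def mult.assoc 3[symmetric] by simp
      qed
      show ?thesis
        using pair unfolding split by (simp add: A_def)
    qed
    \<comment> \<open>A zero of the Bessel factor at \<xi> itself is avoided by rescaling:
      \<open>A\<close> stays nonzero for \<open>t\<close> near 1, and the factor is nonzero for some
      such \<open>t\<close>.\<close>
    have "open {t. A (t *\<^sub>R \<xi>) \<noteq> 0}"
    proof -
      have "continuous_on UNIV (\<lambda>t. A (t *\<^sub>R \<xi>))"
        unfolding A_def
        by (intro continuous_at_imp_continuous_on ballI continuous_at_sequentiallyI continuous_fourier h)
          (auto intro!: tendsto_intros)
      then show ?thesis by (intro open_Collect_neq continuous_intros)
    qed
    from integral_inner_circle_nonzero[OF this, of 1 "- w \<xi>" "norm lam"] ne prod0 show False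
      by auto
  qed
  \<comment> \<open>The twisting phase depends on the horizontal variable beyond the central
    character only, so it can be removed by a test function of \<open>fst g\<close>.\<close>
  have [measurable]: "(\<lambda>x. cis (\<xi> \<bullet> x - (J br \<mu> x \<bullet> P x) / 2)) \<in> borel_measurable borel"
    unfolding P_def by (intro borel_measurable_continuous_onI continuous_intros) auto
  have eq: "h g * cis (\<xi> \<bullet> fst g - (J br \<mu> (fst g) \<bullet> P (fst g)) / 2) = f g * cis (\<xi> \<bullet> fst g - \<mu> \<bullet> snd g)" for g
    unfolding h_def mult.assoc cis_mult by (simp add: algebra_simps)
  have "(LINT g|lborel. h g * cis (\<xi> \<bullet> fst g - (J br \<mu> (fst g) \<bullet> P (fst g)) / 2)) = 0"
    by (rule fourier_uniqueness[OF h, of fst "\<lambda>x. cis (\<xi> \<bullet> x - (J br \<mu> x \<bullet> P x) / 2)"])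
      (use A0 in \<open>auto simp: A_def intro!: integrable_mult_unit[OF h]\<close>)
  then show ?thesis unfolding eq .
qed

end

section \<open>Gaussian moments\<close>

lemma integral_cis_int:
  "(LINT \<theta>:{0..2*pi}|lborel. cis (of_int p * \<theta>)) = (if p = 0 then 2 * pi else 0)"
proof (cases "p = 0")
  case True
  then show ?thesis by (simp add: set_lebesgue_integral_def scaleR_conv_of_real)
next
  case False
  let ?F = "\<lambda>\<theta>. cis (of_int p * \<theta>) / (\<i> * of_int p)"
  have "(LINT \<theta>|lborel. indicator {0..2*pi} \<theta> *\<^sub>R cis (of_int p * \<theta>)) = ?F (2 * pi) - ?F 0"
  proof (rule integral_FTC_Icc)
    show "(?F has_vector_derivative cis (of_int p * x)) (at x within {0..2 * pi})" for x
    proof -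
      have "((\<lambda>\<theta>. exp (\<i> * of_int p * of_real \<theta>) / (\<i> * of_int p)) has_vector_derivative
          exp (\<i> * of_int p * of_real x)) (at x within {0..2 * pi})"
        by (rule has_vector_derivative_real_field)
          (use False in \<open>auto intro!: derivative_eq_intros\<close>)
      then show ?thesis by (simp add: cis_conv_exp mult.assoc)
    qed
  qed (auto intro!: continuous_intros)
  moreover have "cis (of_int p * (2 * pi)) = 1"
    using cis_multiple_2pi[of "of_int p"] by (simp add: mult_ac)
  ultimately show ?thesis using False by (simp add: set_lebesgue_integral_def)
qed

text \<open>Integrating the exponential series termwise, orthogonality of the characters leaves only
  the power \<open>m = - p\<close>, if there is one.\<close>

lemma integral_exp_cis:
  fixes c :: complex
  shows "(LINT \<theta>:{0..2*pi}|lborel. exp (c * cis \<theta>) * cis (of_int p * \<theta>)) =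
    (if p \<le> 0 then 2 * pi * c ^ nat (- p) / fact (nat (- p)) else 0)"
proof -
  let ?f = "\<lambda>m \<theta>. indicator {0..2*pi} \<theta> *\<^sub>R (c ^ m / fact m * cis (of_int (int m + p) * \<theta>))"
  have eq: "c ^ m / fact m * cis (of_int (int m + p) * \<theta>) = (c * cis \<theta>) ^ m /\<^sub>R fact m * cis (of_int p * \<theta>)" for m \<theta>
  proof -
    have "cis (of_int (int m + p) * \<theta>) = cis \<theta> ^ m * cis (of_int p * \<theta>)"
      unfolding Complex.DeMoivre cis_mult by (simp add: distrib_right)
    then show ?thesis by (simp add: power_mult_distrib scaleR_conv_of_real divide_inverse)
  qed
  have sums: "(\<lambda>m. ?f m \<theta>) sums (indicator {0..2*pi} \<theta> *\<^sub>R (exp (c * cis \<theta>) * cis (of_int p * \<theta>)))" for \<theta>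
    unfolding eq by (intro sums_scaleR_right sums_mult2 exp_converges)
  have int: "integrable lborel (?f m)" for m
    unfolding set_integrable_def[symmetric]
    by (intro borel_integrable_atLeastAtMost' continuous_intros)
  have nrm: "norm (?f m \<theta>) = indicator {0..2*pi} \<theta> * (norm c ^ m / fact m)" for m \<theta>
    by (simp add: norm_mult norm_divide norm_power indicator_def)
  have "(\<lambda>m. LINT \<theta>|lborel. ?f m \<theta>) sums (LINT \<theta>|lborel. (\<Sum>m. ?f m \<theta>))"
  proof (rule sums_integral)
    show "AE \<theta> in lborel. summable (\<lambda>m. norm (?f m \<theta>))"
      unfolding nrm using summable_exp[of "norm c"]
      by (intro AE_I2 summable_mult) (simp add: divide_inverse mult.commute)
    show "summable (\<lambda>m. LINT \<theta>|lborel. norm (?f m \<theta>))"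
      unfolding nrm using summable_exp[of "norm c"]
      by (simp add: summable_mult divide_inverse mult.commute)
  qed (rule int)
  moreover have "(LINT \<theta>|lborel. (\<Sum>m. ?f m \<theta>)) = (LINT \<theta>:{0..2*pi}|lborel. exp (c * cis \<theta>) * cis (of_int p * \<theta>))"
    unfolding set_lebesgue_integral_def using sums by (intro Bochner_Integration.integral_cong refl) (simp add: sums_unique[symmetric])
  moreover have "(LINT \<theta>|lborel. ?f m \<theta>) = (if int m + p = 0 then 2 * pi * c ^ m / fact m else 0)" for m
  proof -
    have "(LINT \<theta>|lborel. ?f m \<theta>) = c ^ m / fact m * (LINT \<theta>:{0..2*pi}|lborel. cis (of_int (int m + p) * \<theta>))"
      unfolding set_integral_mult_right[symmetric] by (simp only: set_lebesgue_integral_def)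
    then show ?thesis unfolding integral_cis_int by simp
  qed
  ultimately have s: "(\<lambda>m. if int m + p = 0 then 2 * pi * c ^ m / fact m else 0) sums
      (LINT \<theta>:{0..2*pi}|lborel. exp (c * cis \<theta>) * cis (of_int p * \<theta>))"
    by simp
  show ?thesis
  proof (cases "p \<le> 0")
    case True
    then have "int m + p = 0 \<longleftrightarrow> m = nat (- p)" for m by auto
    with s have "(\<lambda>m. if m = nat (- p) then 2 * pi * c ^ m / fact m else 0) sums
      (LINT \<theta>:{0..2*pi}|lborel. exp (c * cis \<theta>) * cis (of_int p * \<theta>))" by simp
    from sums_unique2[OF this sums_single] True show ?thesis by simp
  next
    case False
    then have "int m + p \<noteq> 0" for m by auto
    with s sums_unique2[OF _ sums_zero] False show ?thesis by auto
  qed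
qed

text \<open>In the binomial expansion the \<open>j\<close>-th term has frequency
  \<open>k - j\<close>, while the exponential supplies nonnegative frequencies only. Hence just
  \<open>j = l + k\<close> with \<open>l \<le> n\<close> survives.\<close>

lemma integral_exp_circle_power:
  fixes c v :: complex and R :: real
  defines "W \<equiv> \<lambda>\<theta>. - \<i> * of_real R * cis \<theta>"
  shows "(LINT \<theta>:{0..2*pi}|lborel. exp (c * W \<theta>) * cis (real k * \<theta>) * (v - cnj (W \<theta>)) ^ (n + k)) =
    2 * pi * (- \<i> * of_real R) ^ k *
    (\<Sum>l\<le>n. of_nat ((n + k) choose (n - l)) / fact l * (- (of_real (R\<^sup>2) * c)) ^ l * v ^ (n - l))"
proof -
  define u where "u = - \<i> * of_real R"
  have W: "c * W \<theta> = c * u * cis \<theta>" "v - cnj (W \<theta>) = u * cis (- \<theta>) + v" for \<theta>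
    by (simp_all add: W_def u_def cis_cnj)
  have u2: "u ^ (l + k) * (c * u) ^ l = u ^ k * (- (of_real (R\<^sup>2) * c)) ^ l" for l
  proof -
    have "u\<^sup>2 = - of_real (R\<^sup>2)" by (simp add: u_def power_mult_distrib)
    moreover have "u * (c * u) = c * u\<^sup>2" by (simp add: power2_eq_square)
    ultimately have "u * (c * u) = - (of_real (R\<^sup>2) * c)" by simp
    then show ?thesis by (simp add: power_add power_mult_distrib[symmetric])
  qed
  let ?a = "\<lambda>j. of_nat ((n + k) choose j) * u ^ j * v ^ (n + k - j)"
  have int: "set_integrable lborel {0..2*pi} (\<lambda>\<theta>. ?a j * (exp (c * u * cis \<theta>) * cis (of_int (int k - int j) * \<theta>)))" for j
    by (intro borel_integrable_atLeastAtMost' continuous_intros)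
  have "exp (c * W \<theta>) * cis (real k * \<theta>) * (v - cnj (W \<theta>)) ^ (n + k) =
      (\<Sum>j\<le>n + k. ?a j * (exp (c * u * cis \<theta>) * cis (of_int (int k - int j) * \<theta>)))" for \<theta>
  proof -
    have "cis (of_int (int k - int j) * \<theta>) = cis (real k * \<theta>) * cis (- \<theta>) ^ j" for j
      unfolding Complex.DeMoivre cis_mult by (simp add: algebra_simps)
    then show ?thesis
      unfolding W binomial_ring by (simp add: sum_distrib_left power_mult_distrib mult_ac)
  qed
  then have "(LINT \<theta>:{0..2*pi}|lborel. exp (c * W \<theta>) * cis (real k * \<theta>) * (v - cnj (W \<theta>)) ^ (n + k)) =
      (LINT \<theta>|lborel. (\<Sum>j\<le>n + k. indicator {0..2*pi} \<theta> *\<^sub>R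
        (?a j * (exp (c * u * cis \<theta>) * cis (of_int (int k - int j) * \<theta>)))))"
    by (simp only: set_lebesgue_integral_def scaleR_sum_right)
  also have "\<dots> = (\<Sum>j\<le>n + k. LINT \<theta>:{0..2*pi}|lborel. ?a j * (exp (c * u * cis \<theta>) * cis (of_int (int k - int j) * \<theta>)))"
    unfolding set_lebesgue_integral_def
    by (rule Bochner_Integration.integral_sum) (rule int[unfolded set_integrable_def])
  also have "\<dots> = (\<Sum>j\<le>n + k. if k \<le> j then ?a j * (2 * pi * (c * u) ^ (j - k) / fact (j - k)) else 0)"
    unfolding set_integral_mult_right integral_exp_cis by (intro sum.cong) (auto simp: nat_diff_distrib)
  also have "\<dots> = (\<Sum>j\<in>{k..n + k}. ?a j * (2 * pi * (c * u) ^ (j - k) / fact (j - k)))"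
    by (rule sum.mono_neutral_cong_right) auto
  also have "\<dots> = (\<Sum>l\<in>{0..n}. ?a (l + k) * (2 * pi * (c * u) ^ l / fact l))"
    using sum.shift_bounds_cl_nat_ivl[of "\<lambda>j. ?a j * (2 * pi * (c * u) ^ (j - k) / fact (j - k))" 0 k n] by simp
  also have "\<dots> = 2 * pi * u ^ k *
    (\<Sum>l\<le>n. of_nat ((n + k) choose (n - l)) / fact l * (- (of_real (R\<^sup>2) * c)) ^ l * v ^ (n - l))"
    unfolding sum_distrib_left atLeast0AtMost
  proof (intro sum.cong refl)
    fix l assume "l \<in> {..n}"
    then have "(n + k) choose (l + k) = (n + k) choose (n - l)" "n + k - (l + k) = n - l"
      using binomial_symmetric[of "l + k" "n + k"] by auto
    then show "?a (l + k) * (2 * pi * (c * u) ^ l / fact l) =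
      2 * pi * u ^ k * (of_nat ((n + k) choose (n - l)) / fact l * (- (of_real (R\<^sup>2) * c)) ^ l * v ^ (n - l))"
      using u2[of l] by (simp add: mult_ac)
  qed
  finally show ?thesis unfolding u_def .
qed

text \<open>The value at \<open>k\<close> of the generalised Laguerre polynomial of degree \<open>n\<close> and parameter \<open>k\<close>.\<close>

definition laguerre_diag :: "nat \<Rightarrow> nat \<Rightarrow> real" where
  "laguerre_diag n k = (\<Sum>l\<le>n. of_nat ((n + k) choose (n - l)) / fact l * (- real k) ^ l)"

text \<open>Writing the binomial coefficients as products shows that the value is a polynomial in
  \<open>k\<close>. At \<open>k = 0\<close> it equals 1, so it has finitely many roots.\<close>

lemma eventually_laguerre_diag_nonzero: "\<forall>\<^sub>F k in sequentially. laguerre_diag n k \<noteq> 0"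
proof -
  define q :: "real poly" where
    "q = (\<Sum>l\<le>n. smult ((-1) ^ l / (fact l * fact (n - l))) (monom 1 l * (\<Prod>i<n - l. [:real n - real i, 1:])))"
  have q: "poly q x = (\<Sum>l\<le>n. ((real n + x) gchoose (n - l)) / fact l * (- x) ^ l)" for x
    unfolding q_def
    by (simp add: poly_sum poly_prod poly_monom gbinomial_prod_rev power_minus[of x] atLeast0LessThan
        algebra_simps cong: prod.cong)
  have "poly q 0 = (\<Sum>l\<le>n. if l = 0 then 1 else 0)"
    unfolding q by (intro sum.cong) (auto simp: binomial_gbinomial[symmetric])
  then have "q \<noteq> 0" by auto
  then have "finite {x. poly q x = 0}" by (rule poly_roots_finite)
  then have "finite {k::nat. poly q (real k) = 0}"
    using finite_vimageI[of "{x. poly q x = 0}" real] by (simp add: inj_on_def vimage_def)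
  moreover have "laguerre_diag n k = poly q (real k)" for k
    unfolding q laguerre_diag_def by (simp add: binomial_gbinomial)
  ultimately show ?thesis
    by (simp add: eventually_cofinite cofinite_eq_sequentially[symmetric])
qed

text \<open>The power is absorbed by \<open>t ^ n \<le> fact n * exp t\<close>, which raises
  \<open>b\<close> by 1; completing the square does the rest.\<close>

lemma exp_quadratic_power_bound:
  fixes b c :: real
  assumes "c > 0" "t \<ge> 0"
  shows "exp (b * t - c * t\<^sup>2) * t ^ n \<le> fact n * exp ((b + 1)\<^sup>2 / (4 * c))"
proof -
  have "t ^ n / fact n \<le> exp t"
  proof -
    have "(\<Sum>m\<in>{n}. t ^ m /\<^sub>R fact m) \<le> exp t"
      unfolding exp_def by (rule sum_le_suminf[OF summable_exp_generic]) (use assms in auto)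
    then show ?thesis by (simp add: divide_inverse mult.commute)
  qed
  then have "t ^ n \<le> fact n * exp t" by (simp add: field_simps)
  then have "exp (b * t - c * t\<^sup>2) * t ^ n \<le> exp (b * t - c * t\<^sup>2) * (fact n * exp t)"
    by (intro mult_left_mono) auto
  also have "\<dots> = fact n * exp ((b + 1) * t - c * t\<^sup>2)"
    by (simp add: exp_add[symmetric] algebra_simps)
  also have "(b + 1) * t - c * t\<^sup>2 \<le> (b + 1)\<^sup>2 / (4 * c)"
  proof -
    have "0 \<le> (2 * c * t - (b + 1))\<^sup>2" by simp
    then show ?thesis using assms by (simp add: field_simps power2_eq_square)
  qed
  finally show ?thesis by simp
qed

text \<open>The bound depends on a lower bound \<open>c\<close> of the width parameter only, so it
  stays uniform while \<tau> varies in a limit.\<close>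

lemma norm_gaussian_power_le:
  fixes z :: complex
  assumes "c > 0" "c \<le> \<tau>"
  shows "norm (exp (- of_real (\<tau> * (norm z)\<^sup>2) + \<alpha> * z) * cnj z ^ n) \<le> fact n * exp ((norm \<alpha> + 1)\<^sup>2 / (4 * c))"
proof -
  have "norm (exp (- of_real (\<tau> * (norm z)\<^sup>2) + \<alpha> * z)) \<le> exp (norm \<alpha> * norm z - c * (norm z)\<^sup>2)"
    using abs_Re_le_cmod[of "\<alpha> * z"] mult_right_mono[OF assms(2), of "(norm z)\<^sup>2"]
    by (simp add: norm_mult)
  then have "norm (exp (- of_real (\<tau> * (norm z)\<^sup>2) + \<alpha> * z) * cnj z ^ n) \<le>
      exp (norm \<alpha> * norm z - c * (norm z)\<^sup>2) * norm z ^ n"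
    by (simp add: norm_mult norm_power mult_right_mono)
  also have "\<dots> \<le> fact n * exp ((norm \<alpha> + 1)\<^sup>2 / (4 * c))"
    by (rule exp_quadratic_power_bound) (use assms in auto)
  finally show ?thesis .
qed

text \<open>Every summand has degree at most \<open>n\<close>, and taking the top coefficient of
  each linear factor replaces \<open>a - k v\<close> by \<open>- k\<close>; the sum of these is the
  Laguerre value.\<close>

lemma laguerre_poly:
  fixes a :: complex
  shows "\<exists>p. degree p \<le> n \<and> coeff p n = of_real (laguerre_diag n k) \<and>
    (\<forall>v. poly p v = (\<Sum>l\<le>n. of_nat ((n + k) choose (n - l)) / fact l * (a - of_nat k * v) ^ l * v ^ (n - l)))"
proof -
  define q where "q l = monom 1 (n - l) * [:a, - of_nat k:] ^ l" for l
  define p where "p = (\<Sum>l\<le>n. smult (of_nat ((n + k) choose (n - l)) / fact l) (q l))"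
  have "degree (q l) \<le> n" if "l \<le> n" for l
  proof -
    have "degree ([:a, - of_nat k:] ^ l) \<le> degree [:a, - of_nat k:] * l"
      by (rule degree_power_le)
    also have "\<dots> \<le> l" by simp
    finally have "degree ([:a, - of_nat k:] ^ l) \<le> l" .
    then show ?thesis
      using degree_mult_le[of "monom 1 (n - l)" "[:a, - of_nat k:] ^ l"] degree_monom_le[of "1::complex" "n - l"] that
      unfolding q_def by linarith
  qed
  then have "degree p \<le> n"
    unfolding p_def by (intro degree_sum_le) (auto intro: order_trans[OF degree_smult_le])
  moreover have "coeff (q l) n = (- of_nat k) ^ l" if "l \<le> n" for l
    using that unfolding q_def coeff_monom_mult by (simp add: coeff_linear_poly_power)
  then have "coeff p n = of_real (laguerre_diag n k)"
    by (simp add: p_def coeff_sum laguerre_diag_def)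
  moreover have "poly p v = (\<Sum>l\<le>n. of_nat ((n + k) choose (n - l)) / fact l * (a - of_nat k * v) ^ l * v ^ (n - l))" for v
    unfolding p_def q_def by (simp add: poly_sum poly_monom mult_ac)
  ultimately show ?thesis by blast
qed

context h_type_group
begin

text \<open>For the Gaussian of this width the phase makes the dependence of the exponent on \<open>W\<close> holomorphic,
  so the circle integral is a polynomial of degree \<open>n\<close> in \<open>cnj w\<close> and, for nonvanishing leading
  coefficient, the moments vanish one after the other.\<close>

lemma gaussian_moment_eq_0:
  assumes \<nu>: "norm \<nu> = 1" and lam: "lam \<noteq> 0" and f: "integrable lborel f" and z: "xray_zero br \<nu> lam f"
    and \<mu>: "\<mu> \<bullet> sgn lam = 2 * real k * (norm lam)\<^sup>2"
    and k: "k > 0" and L: "\<And>i. i \<le> n \<Longrightarrow> laguerre_diag i k \<noteq> 0"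
  defines "w \<equiv> plane_coord \<nu> (sgn lam)" and "P \<equiv> plane_proj \<nu> (sgn lam)"
    and "\<sigma> \<equiv> real k * (norm lam)\<^sup>2 / 2"
  shows "(LINT g|lborel. f g * cis (- (\<mu> \<bullet> snd g) + (J br \<mu> (fst g) \<bullet> P (fst g)) / 2 + \<xi> \<bullet> (fst g - P (fst g))) *
     (exp (- of_real (\<sigma> * (norm (w (fst g)))\<^sup>2) + \<alpha> * w (fst g)) * cnj (w (fst g)) ^ n)) = 0"
  using L
proof (induction n rule: less_induct)
  case (less n)
  define h where "h g = f g * cis (- (\<mu> \<bullet> snd g) + (J br \<mu> (fst g) \<bullet> P (fst g)) / 2 + \<xi> \<bullet> (fst g - P (fst g)))" for g
  define e where "e v = exp (- of_real (\<sigma> * (norm v)\<^sup>2) + \<alpha> * v)" for v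
  define W where "W \<theta> = - \<i> * cis \<theta> / norm lam" for \<theta>
  define R where "R = 1 / norm lam"
  have W: "W \<theta> = - \<i> * of_real R * cis \<theta>" for \<theta> by (simp add: W_def R_def)
  have R\<sigma>: "2 * \<sigma> * R\<^sup>2 = real k" "2 * \<sigma> = real k * (norm lam)\<^sup>2"
    using lam by (simp_all add: R_def \<sigma>_def power_divide)
  have \<sigma>: "\<sigma> > 0" using k lam by (simp add: \<sigma>_def)
  have mc: "(\<lambda>g. cis (- (\<mu> \<bullet> snd g) + (J br \<mu> (fst g) \<bullet> P (fst g)) / 2 + \<xi> \<bullet> (fst g - P (fst g)))) \<in> borel_measurable borel"
    unfolding P_def by (intro borel_measurable_continuous_onI continuous_intros) auto
  have h: "integrable lborel h"
    unfolding h_def by (rule integrable_mult_unit[OF f]) (use mc in auto)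
  define E where "E i = (LINT g|lborel. h g * (e (w (fst g)) * cnj (w (fst g)) ^ i))" for i
  have int: "integrable lborel (\<lambda>g. h g * (e (w (fst g)) * cnj (w (fst g)) ^ i))" for i
  proof (rule integrable_mult_bounded[OF h])
    show "norm (e (w (fst g)) * cnj (w (fst g)) ^ i) \<le> fact i * exp ((norm \<alpha> + 1)\<^sup>2 / (4 * \<sigma>))" for g :: "'v \<times> 'z"
      unfolding e_def by (rule norm_gaussian_power_le) (use \<sigma> in auto)
    have "(\<lambda>g :: 'v \<times> 'z. e (w (fst g)) * cnj (w (fst g)) ^ i) \<in> borel_measurable borel"
      unfolding e_def w_def by (intro borel_measurable_continuous_onI continuous_intros)
    then show "(\<lambda>g :: 'v \<times> 'z. e (w (fst g)) * cnj (w (fst g)) ^ i) \<in> borel_measurable lborel" by simp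
  qed
  \<comment> \<open>The twist \<open>cis (k * \<theta>)\<close> uses up \<open>k\<close> powers,
    which leaves degree \<open>n\<close> in \<open>cnj v\<close> after integration.\<close>
  define \<psi> where "\<psi> v = e v * cnj v ^ (n + k)" for v
  have \<psi>_meas: "\<psi> \<in> borel_measurable borel"
    unfolding \<psi>_def e_def by (intro borel_measurable_continuous_onI continuous_intros)
  have \<psi>_bound: "norm (\<psi> v) \<le> fact (n + k) * exp ((norm \<alpha> + 1)\<^sup>2 / (4 * \<sigma>))" for v
    unfolding \<psi>_def e_def by (rule norm_gaussian_power_le) (use \<sigma> in auto)
  obtain p where p: "degree p \<le> n" "coeff p n = of_real (laguerre_diag n k)"
      "\<And>v. poly p v = (\<Sum>l\<le>n. of_nat ((n + k) choose (n - l)) / fact l * (of_real (R\<^sup>2) * \<alpha> - of_nat k * v) ^ l * v ^ (n - l))"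
    using laguerre_poly by metis
  define c where "c = exp (- of_real (\<sigma> * R\<^sup>2)) * (2 * pi * (- \<i> * of_real R) ^ k)"
  have c: "c \<noteq> 0" using lam by (simp add: c_def R_def)
  have K: "(LINT \<theta>:{0..2*pi}|lborel. \<psi> (v - W \<theta>) *
        cis (real k * \<theta> + real k * (norm lam)\<^sup>2 * Im (cnj v * W \<theta>))) = e v * (c * poly p (cnj v))" for v
  proof -
    \<comment> \<open>Expanding the Gaussian gives 2 \<sigma> times the real part of
      \<open>cnj v * W \<theta>\<close>, and the twist gives i times its imaginary part with the
      same factor, since 2 \<sigma> = k |lam|^2. Together they are linear in
      \<open>W \<theta>\<close>.\<close>
    let ?c = "2 * of_real \<sigma> * cnj v - \<alpha>"
    have "\<psi> (v - W \<theta>) * cis (real k * \<theta> + real k * (norm lam)\<^sup>2 * Im (cnj v * W \<theta>)) =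
      e v * exp (- of_real (\<sigma> * R\<^sup>2)) * (exp (?c * W \<theta>) * cis (real k * \<theta>) * (cnj v - cnj (W \<theta>)) ^ (n + k))" for \<theta>
    proof -
      have nW: "(norm (W \<theta>))\<^sup>2 = R\<^sup>2" by (simp add: W norm_mult)
      have nv: "(norm (v - W \<theta>))\<^sup>2 = (norm v)\<^sup>2 + R\<^sup>2 - 2 * Re (cnj v * W \<theta>)"
        unfolding nW[symmetric] cmod_power2 by (simp add: power2_eq_square algebra_simps)
      have "- of_real (\<sigma> * (N + R\<^sup>2 - 2 * a)) + \<alpha> * (v - W \<theta>) + \<i> * of_real (2 * \<sigma> * b) =
        (- of_real (\<sigma> * N) + \<alpha> * v) + - of_real (\<sigma> * R\<^sup>2) +
        (2 * of_real \<sigma> * (of_real a + \<i> * of_real b) - \<alpha> * W \<theta>)" for N a b :: real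
        by (simp add: algebra_simps)
      note exponent = this[of "(norm v)\<^sup>2" "Re (cnj v * W \<theta>)" "Im (cnj v * W \<theta>)", folded nv complex_eq]
      have cW: "?c * W \<theta> = 2 * of_real \<sigma> * (cnj v * W \<theta>) - \<alpha> * W \<theta>"
        by (simp add: algebra_simps)
      have "e (v - W \<theta>) * cis (2 * \<sigma> * Im (cnj v * W \<theta>)) = e v * exp (- of_real (\<sigma> * R\<^sup>2)) * exp (?c * W \<theta>)"
        unfolding e_def cis_conv_exp cW exp_add[symmetric] exponent ..
      then show ?thesis
        unfolding \<psi>_def R\<sigma>(2)[symmetric] cis_mult[symmetric] by (simp add: mult_ac)
    qed
    then have "(LINT \<theta>:{0..2*pi}|lborel. \<psi> (v - W \<theta>) *
        cis (real k * \<theta> + real k * (norm lam)\<^sup>2 * Im (cnj v * W \<theta>))) =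
      e v * exp (- of_real (\<sigma> * R\<^sup>2)) *
      (LINT \<theta>:{0..2*pi}|lborel. exp (?c * W \<theta>) * cis (real k * \<theta>) * (cnj v - cnj (W \<theta>)) ^ (n + k))"
      by (simp only: set_integral_mult_right)
    moreover have "(of_nat k :: complex) = of_real (2 * \<sigma> * R\<^sup>2)"
      unfolding R\<sigma>(1) by simp
    then have "- (of_real (R\<^sup>2) * ?c) = of_real (R\<^sup>2) * \<alpha> - of_nat k * cnj v"
      by (simp add: algebra_simps)
    then have "(LINT \<theta>:{0..2*pi}|lborel. exp (?c * W \<theta>) * cis (real k * \<theta>) * (cnj v - cnj (W \<theta>)) ^ (n + k)) =
       2 * pi * (- \<i> * of_real R) ^ k * poly p (cnj v)"
      unfolding W integral_exp_circle_power p(3) by simp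
    ultimately show ?thesis by (simp only: c_def mult_ac)
  qed
  have "(LINT g|lborel. h g * (e (w (fst g)) * (c * poly p (cnj (w (fst g)))))) = 0"
    using plane_pairing[OF \<nu> lam f z \<mu> \<psi>_meas \<psi>_bound, of \<xi>]
    unfolding W_def[symmetric] w_def[symmetric] K h_def P_def .
  moreover have "h g * (e (w (fst g)) * (c * poly p (cnj (w (fst g))))) =
      (\<Sum>i\<le>n. c * coeff p i * (h g * (e (w (fst g)) * cnj (w (fst g)) ^ i)))" for g
  proof -
    have "poly p v = (\<Sum>i\<le>n. coeff p i * v ^ i)" for v
      unfolding poly_altdef by (rule sum.mono_neutral_left) (use p(1) in \<open>auto simp: coeff_eq_0\<close>)
    then show ?thesis by (simp add: sum_distrib_left mult_ac)
  qed
  ultimately have "(\<Sum>i\<le>n. c * coeff p i * E i) = 0"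
    using int by (simp add: E_def)
  moreover have "E i = 0" if "i < n" for i
    using less.IH[OF that] less.prems that unfolding E_def h_def e_def by auto
  ultimately have "c * coeff p n * E n = 0"
    by (simp add: lessThan_Suc_atMost[symmetric])
  then have "E n = 0"
    using c p(2) less.prems[of n] by auto
  then show ?case unfolding E_def h_def e_def .
qed

section \<open>The limit of small \<open>lam\<close>\<close>

lemma bounded_bilinear_J: "bounded_bilinear (J br)"
proof -
  have "linear (\<lambda>\<mu>. J br \<mu> x)" for x
    by (intro linearI J_add_left J_scaleR_left)
  then show ?thesis
    unfolding bilinear_conv_bounded_bilinear[symmetric] bilinear_def using linear_J by auto
qed

lemmas tendsto_J [tendsto_intros] = bounded_bilinear.tendsto[OF bounded_bilinear_J]

lemma tendsto_plane_coord [tendsto_intros]: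
  assumes "(\<nu> \<longlongrightarrow> \<nu>0) F" "(\<omega> \<longlongrightarrow> \<omega>0) F"
  shows "((\<lambda>i. plane_coord (\<nu> i) (\<omega> i) x) \<longlongrightarrow> plane_coord \<nu>0 \<omega>0 x) F"
  unfolding plane_coord_def by (intro tendsto_intros assms)

lemma tendsto_plane_vec [tendsto_intros]:
  assumes "(\<nu> \<longlongrightarrow> \<nu>0) F" "(\<omega> \<longlongrightarrow> \<omega>0) F" "(w \<longlongrightarrow> w0) F"
  shows "((\<lambda>i. plane_vec (\<nu> i) (\<omega> i) (w i)) \<longlongrightarrow> plane_vec \<nu>0 \<omega>0 w0) F"
  unfolding plane_vec_def by (intro tendsto_intros assms)

text \<open>Only the discrete set of \<open>\<mu>\<close> with \<open>\<mu> \<bullet> sgn (lam i) = 2 k |lam i|\<^sup>2\<close> is accessible for each \<open>i\<close>, but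
  it becomes dense as \<open>lam i\<close> tends to zero. Since then \<open>k\<close> tends to infinity, the Laguerre values do
  not vanish in the limit process.\<close>

lemma limit_gaussian_moment_eq_0:
  fixes lam :: "nat \<Rightarrow> 'z" and \<nu> :: "nat \<Rightarrow> 'v"
  assumes f: "integrable lborel f"
    and lam: "\<And>i. lam i \<noteq> 0" "lam \<longlonglongrightarrow> 0" "(\<lambda>i. sgn (lam i)) \<longlonglongrightarrow> \<omega>"
    and \<nu>: "\<And>i. norm (\<nu> i) = 1" "\<nu> \<longlonglongrightarrow> \<nu>0"
    and z: "\<And>i. xray_zero br (\<nu> i) (lam i) f"
    and \<mu>: "\<mu> \<bullet> \<omega> > 0"
  defines "w \<equiv> plane_coord \<nu>0 \<omega>" and "P \<equiv> plane_proj \<nu>0 \<omega>"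
  shows "(LINT g|lborel. f g * cis (- (\<mu> \<bullet> snd g) + (J br \<mu> (fst g) \<bullet> P (fst g)) / 2 + \<xi> \<bullet> (fst g - P (fst g))) *
     (exp (- of_real (\<mu> \<bullet> \<omega> / 4 * (norm (w (fst g)))\<^sup>2) + \<alpha> * w (fst g)) * cnj (w (fst g)) ^ n)) = 0"
proof -
  define \<omega>' where "\<omega>' i = sgn (lam i)" for i
  have \<omega>': "\<omega>' i \<bullet> \<omega>' i = 1" for i
    using lam(1) by (simp add: \<omega>'_def norm_sgn norm_eq_1[symmetric])
  have \<omega>'_lim: "\<omega>' \<longlonglongrightarrow> \<omega>" using lam(3) unfolding \<omega>'_def .
  \<comment> \<open>Rounding up makes the rounding error \<open>d i\<close> lie eventually between 0
    and 2 |lam i|^2. Moving \<mu> by \<open>d i\<close> along the direction of \<open>lam i\<close>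
    makes it exactly admissible and converges back to \<mu>.\<close>
  define k where "k i = nat \<lceil>\<mu> \<bullet> \<omega>' i / (2 * (norm (lam i))\<^sup>2)\<rceil>" for i
  define d where "d i = 2 * real (k i) * (norm (lam i))\<^sup>2 - \<mu> \<bullet> \<omega>' i" for i
  define \<mu>' where "\<mu>' i = \<mu> + d i *\<^sub>R \<omega>' i" for i
  define \<sigma> where "\<sigma> i = real (k i) * (norm (lam i))\<^sup>2 / 2" for i
  have \<mu>': "\<mu>' i \<bullet> sgn (lam i) = 2 * real (k i) * (norm (lam i))\<^sup>2" for i
    using \<omega>'[of i] by (simp add: \<mu>'_def d_def inner_add_left flip: \<omega>'_def)
  have lim_\<mu>\<omega>: "(\<lambda>i. \<mu> \<bullet> \<omega>' i) \<longlonglongrightarrow> \<mu> \<bullet> \<omega>"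
    by (intro tendsto_intros \<omega>'_lim)
  then have ev_pos: "\<forall>\<^sub>F i in sequentially. \<mu> \<bullet> \<omega>' i > (\<mu> \<bullet> \<omega>) / 2"
    using \<mu> by (intro order_tendstoD) auto
  have d_bounds: "\<forall>\<^sub>F i in sequentially. 0 \<le> d i \<and> d i \<le> 2 * (norm (lam i))\<^sup>2"
    using ev_pos
  proof eventually_elim
    case (elim i)
    let ?q = "\<mu> \<bullet> \<omega>' i / (2 * (norm (lam i))\<^sup>2)"
    have "?q > 0" using elim \<mu> lam(1)[of i] by simp
    then have "?q \<le> real (k i)" "real (k i) \<le> ?q + 1"
      unfolding k_def by linarith+
    then show ?case
      using lam(1)[of i] by (simp add: d_def field_simps)
  qed
  have d_lim: "d \<longlonglongrightarrow> 0"
  proof (rule tendsto_sandwich[of "\<lambda>_. 0" d _ "\<lambda>i. 2 * (norm (lam i))\<^sup>2"])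
    have "(\<lambda>i. 2 * (norm (lam i))\<^sup>2) \<longlonglongrightarrow> 2 * (norm (0::'z))\<^sup>2"
      by (intro tendsto_intros lam)
    then show "(\<lambda>i. 2 * (norm (lam i))\<^sup>2) \<longlonglongrightarrow> 0" by simp
  qed (use d_bounds in \<open>auto elim: eventually_mono\<close>)
  have \<mu>'_lim: "\<mu>' \<longlonglongrightarrow> \<mu>"
  proof -
    have "(\<lambda>i. \<mu> + d i *\<^sub>R \<omega>' i) \<longlonglongrightarrow> \<mu> + 0 *\<^sub>R \<omega>"
      by (intro tendsto_intros d_lim \<omega>'_lim)
    then show ?thesis unfolding \<mu>'_def by simp
  qed
  have \<sigma>_lim: "\<sigma> \<longlonglongrightarrow> \<mu> \<bullet> \<omega> / 4"
  proof -
    have "\<sigma> = (\<lambda>i. (d i + \<mu> \<bullet> \<omega>' i) / 4)"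
      by (simp add: \<sigma>_def d_def fun_eq_iff)
    moreover have "(\<lambda>i. (d i + \<mu> \<bullet> \<omega>' i) / 4) \<longlonglongrightarrow> (0 + \<mu> \<bullet> \<omega>) / 4"
      by (intro tendsto_intros d_lim \<omega>'_lim) simp
    ultimately show ?thesis by simp
  qed
  \<comment> \<open>Half of the limiting width parameter serves as the common lower bound for
    domination.\<close>
  then have ev_\<sigma>: "\<forall>\<^sub>F i in sequentially. \<sigma> i > \<mu> \<bullet> \<omega> / 8"
    using \<mu> by (intro order_tendstoD) auto
  have k_lim: "filterlim k at_top sequentially"
  proof -
    have "(\<lambda>i. (norm (lam i))\<^sup>2) \<longlonglongrightarrow> (norm (0::'z))\<^sup>2"
      by (intro tendsto_intros lam)
    then have "filterlim (\<lambda>i. inverse ((norm (lam i))\<^sup>2)) at_top sequentially"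
      using lam(1) by (intro filterlim_inverse_at_top) (auto intro!: always_eventually)
    moreover have "(\<lambda>i. 2 * \<sigma> i) \<longlonglongrightarrow> 2 * (\<mu> \<bullet> \<omega> / 4)"
      by (intro tendsto_intros \<sigma>_lim)
    ultimately have "filterlim (\<lambda>i. 2 * \<sigma> i * inverse ((norm (lam i))\<^sup>2)) at_top sequentially"
      using \<mu> by (intro filterlim_tendsto_pos_mult_at_top[of _ "2 * (\<mu> \<bullet> \<omega> / 4)"]) auto
    moreover have "2 * \<sigma> i * inverse ((norm (lam i))\<^sup>2) = real (k i)" for i
      using lam(1)[of i] by (simp add: \<sigma>_def)
    ultimately show ?thesis
      by (simp add: filterlim_sequentially_iff_filterlim_real)
  qed
  have ev_L: "\<forall>\<^sub>F i in sequentially. \<forall>j\<in>{..n}. laguerre_diag j (k i) \<noteq> 0"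
  proof -
    have "\<forall>\<^sub>F k in sequentially. \<forall>j\<in>{..n}. laguerre_diag j k \<noteq> 0"
      by (intro eventually_ball_finite ballI eventually_laguerre_diag_nonzero) auto
    then show ?thesis
      using k_lim by (rule eventually_compose_filterlim)
  qed
  have ev_k: "\<forall>\<^sub>F i in sequentially. k i > 0"
  proof -
    have "\<forall>\<^sub>F i in sequentially. 1 \<le> k i"
      using k_lim by (simp add: filterlim_at_top)
    then show ?thesis by eventually_elim simp
  qed
  define G where "G i g = cis (- (\<mu>' i \<bullet> snd g) + (J br (\<mu>' i) (fst g) \<bullet> plane_proj (\<nu> i) (\<omega>' i) (fst g)) / 2
        + \<xi> \<bullet> (fst g - plane_proj (\<nu> i) (\<omega>' i) (fst g))) *
     (exp (- of_real (\<sigma> i * (norm (plane_coord (\<nu> i) (\<omega>' i) (fst g)))\<^sup>2) + \<alpha> * plane_coord (\<nu> i) (\<omega>' i) (fst g))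
       * cnj (plane_coord (\<nu> i) (\<omega>' i) (fst g)) ^ n)" for i g
  define G0 where "G0 g = cis (- (\<mu> \<bullet> snd g) + (J br \<mu> (fst g) \<bullet> plane_proj \<nu>0 \<omega> (fst g)) / 2
        + \<xi> \<bullet> (fst g - plane_proj \<nu>0 \<omega> (fst g))) *
     (exp (- of_real (\<mu> \<bullet> \<omega> / 4 * (norm (plane_coord \<nu>0 \<omega> (fst g)))\<^sup>2) + \<alpha> * plane_coord \<nu>0 \<omega> (fst g))
       * cnj (plane_coord \<nu>0 \<omega> (fst g)) ^ n)" for g
  have G_lim: "(\<lambda>i. G i g) \<longlonglongrightarrow> G0 g" for g
    unfolding G_def G0_def
    by (intro tendsto_intros \<mu>'_lim \<nu>(2) \<omega>'_lim \<sigma>_lim) auto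
  have G_meas: "G i \<in> borel_measurable lborel" for i
  proof -
    have "G i \<in> borel_measurable borel"
      unfolding G_def by (intro borel_measurable_continuous_onI continuous_intros) auto
    then show ?thesis by simp
  qed
  have G0_meas: "G0 \<in> borel_measurable lborel"
  proof -
    have "G0 \<in> borel_measurable borel"
      unfolding G0_def by (intro borel_measurable_continuous_onI continuous_intros) auto
    then show ?thesis by simp
  qed
  define C where "C = fact n * exp ((norm \<alpha> + 1)\<^sup>2 / (4 * (\<mu> \<bullet> \<omega> / 8)))"
  have "\<forall>\<^sub>F i in sequentially. (LINT g|lborel. f g * G i g) = 0 \<and> (\<forall>g. norm (G i g) \<le> C)"
    using ev_L ev_k ev_\<sigma>
  proof eventually_elim
    case (elim i)
    have "norm (G i g) \<le> C" for g
      unfolding G_def C_def norm_mult[of "cis _"] norm_cis mult_1_left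
      by (rule norm_gaussian_power_le) (use elim \<mu> in auto)
    moreover have "(LINT g|lborel. f g * G i g) = 0"
      using gaussian_moment_eq_0[OF \<nu>(1)[of i] lam(1)[of i] f z[of i] \<mu>'[of i] elim(2), where n=n and \<xi>=\<xi> and \<alpha>=\<alpha>] elim(1)
      by (simp add: G_def \<omega>'_def \<sigma>_def mult.assoc)
    ultimately show ?case by blast
  qed
  then obtain N where N: "\<And>i. i \<ge> N \<Longrightarrow> (LINT g|lborel. f g * G i g) = 0" "\<And>i g. i \<ge> N \<Longrightarrow> norm (G i g) \<le> C"
    unfolding eventually_sequentially by blast
  have "(\<lambda>i. LINT g|lborel. f g * G (i + N) g) \<longlonglongrightarrow> (LINT g|lborel. f g * G0 g)"
  proof (rule integral_dominated_convergence[where w="\<lambda>g. C * norm (f g)"])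
    note [measurable] = borel_measurable_integrable[OF f] G_meas G0_meas
    show "(\<lambda>g. f g * G0 g) \<in> borel_measurable lborel" "\<And>i. (\<lambda>g. f g * G (i + N) g) \<in> borel_measurable lborel"
      by measurable
    show "integrable lborel (\<lambda>g. C * norm (f g))" using f by simp
    show "AE g in lborel. (\<lambda>i. f g * G (i + N) g) \<longlonglongrightarrow> f g * G0 g"
      by (intro AE_I2 tendsto_intros LIMSEQ_ignore_initial_segment[OF G_lim])
    show "AE g in lborel. norm (f g * G (i + N) g) \<le> C * norm (f g)" for i
      using N(2)[of "i + N"] by (intro AE_I2) (simp add: norm_mult mult.commute[of C] mult_left_mono)
  qed
  then have "(LINT g|lborel. f g * G0 g) = 0"
    using N(1) by (simp add: LIMSEQ_const_iff)
  then show ?thesis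
    by (simp add: G0_def w_def P_def mult.assoc)
qed

text \<open>The exponential series sums the vanishing moments to the horizontal Fourier transform of
  the Gaussian-damped, phase-twisted function. Uniqueness then permits a test function that undoes
  both the phase and the damping.\<close>

lemma fourier_eq_0_if_accumulating:
  fixes lam :: "nat \<Rightarrow> 'z" and \<nu> :: "nat \<Rightarrow> 'v"
  assumes f: "integrable lborel f"
    and lam: "\<And>i. lam i \<noteq> 0" "lam \<longlonglongrightarrow> 0" "(\<lambda>i. sgn (lam i)) \<longlonglongrightarrow> \<omega>"
    and \<nu>: "\<And>i. norm (\<nu> i) = 1" "\<nu> \<longlonglongrightarrow> \<nu>0"
    and z: "\<And>i. xray_zero br (\<nu> i) (lam i) f"
    and \<mu>: "\<mu> \<bullet> \<omega> > 0"
  shows "(LINT g|lborel. f g * cis (\<xi> \<bullet> fst g - \<mu> \<bullet> snd g)) = 0"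
proof -
  have \<nu>0: "norm \<nu>0 = 1"
    using tendsto_norm[OF \<nu>(2)] \<nu>(1) by (simp add: LIMSEQ_const_iff)
  have \<omega>: "norm \<omega> = 1"
    using tendsto_norm[OF lam(3)] lam(1) by (simp add: norm_sgn LIMSEQ_const_iff)
  define w where "w = plane_coord \<nu>0 \<omega>"
  define P where "P x = plane_proj \<nu>0 \<omega> x" for x
  define \<sigma> where "\<sigma> = \<mu> \<bullet> \<omega> / 4"
  have \<sigma>: "\<sigma> > 0" using \<mu> by (simp add: \<sigma>_def)
  define p where "p g = cis (- (\<mu> \<bullet> snd g) + (J br \<mu> (fst g) \<bullet> P (fst g)) / 2)" for g
  define h where "h g = f g * (p g * exp (- of_real (\<sigma> * (norm (w (fst g)))\<^sup>2)))" for g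
  have moments: "(LINT g|lborel. f g * cis (- (\<mu> \<bullet> snd g) + (J br \<mu> (fst g) \<bullet> P (fst g)) / 2 + \<xi> \<bullet> (fst g - P (fst g))) *
     (exp (- of_real (\<sigma> * (norm (w (fst g)))\<^sup>2) + \<alpha> * w (fst g)) * cnj (w (fst g)) ^ n)) = 0" for \<xi> \<alpha> n
    unfolding w_def P_def \<sigma>_def by (rule limit_gaussian_moment_eq_0[OF f lam \<nu> z \<mu>])
  have w_cont [continuous_intros]: "continuous_on S t \<Longrightarrow> continuous_on S (\<lambda>x. w (t x))" for S and t :: "'x::topological_space \<Rightarrow> 'v"
    unfolding w_def by (intro continuous_intros)
  have P_cont [continuous_intros]: "continuous_on S t \<Longrightarrow> continuous_on S (\<lambda>x. P (t x))" for S and t :: "'x::topological_space \<Rightarrow> 'v"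
    unfolding P_def by (intro continuous_intros)
  have [measurable]: "f \<in> borel_measurable borel"
    using borel_measurable_integrable[OF f] by simp
  have h: "integrable lborel h"
    unfolding h_def
  proof (rule integrable_mult_unit[OF f])
    have "(\<lambda>g. p g * exp (- of_real (\<sigma> * (norm (w (fst g)))\<^sup>2))) \<in> borel_measurable borel"
      unfolding p_def by (intro borel_measurable_continuous_onI continuous_intros) auto
    then show "(\<lambda>g. p g * exp (- of_real (\<sigma> * (norm (w (fst g)))\<^sup>2))) \<in> borel_measurable lborel" by simp
    show "norm (p g * exp (- of_real (\<sigma> * (norm (w (fst g)))\<^sup>2))) \<le> 1" for g
      using \<sigma> by (simp add: p_def norm_mult)
  qed
  have h0: "(LINT g|lborel. h g * cis (\<xi> \<bullet> fst g)) = 0" for \<xi>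
  proof -
    define \<eta> where "\<eta> = w \<xi>"
    \<comment> \<open>The real character of \<open>\<eta>\<close> is split into a holomorphic and an
      antiholomorphic exponential: the first is built into the moments, the second is expanded in
      powers of \<open>cnj w\<close>.\<close>
    define \<alpha> where "\<alpha> = \<i> * cnj \<eta> / 2"
    define \<beta> where "\<beta> = \<i> * \<eta> / 2"
    have \<alpha>\<beta>: "\<alpha> * v + \<beta> * cnj v = \<i> * of_real (\<eta> \<bullet> v)" for v
      by (simp add: \<alpha>_def \<beta>_def complex_eq_iff inner_complex_def field_simps)
    define q where "q g = cis (- (\<mu> \<bullet> snd g) + (J br \<mu> (fst g) \<bullet> P (fst g)) / 2 + \<xi> \<bullet> (fst g - P (fst g)))" for g
    define e where "e v = exp (- of_real (\<sigma> * (norm v)\<^sup>2) + \<alpha> * v)" for v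
    define T where "T m v = (\<Sum>n<m. (\<beta> * cnj v) ^ n /\<^sub>R fact n)" for m v
    have q_meas: "(\<lambda>g. q g * e (w (fst g)) * t (fst g)) \<in> borel_measurable borel"
      if "continuous_on UNIV t" for t
      unfolding q_def e_def
      by (intro borel_measurable_continuous_onI continuous_intros continuous_on_compose2[OF that]) auto
    \<comment> \<open>All partial sums \<open>T m\<close> are bounded by the exponential of
      |\<beta>| |v|, which the Gaussian absorbs; the 1 stems from the general bound with power
      0.\<close>
    define B where "B = exp ((norm \<alpha> + norm \<beta> + 1)\<^sup>2 / (4 * \<sigma>))"
    have T_bound: "norm (q g * e v * T m v) \<le> B" for g v m
    proof -
      have "norm (T m v) \<le> (\<Sum>n<m. (norm \<beta> * norm v) ^ n /\<^sub>R fact n)"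
        unfolding T_def by (rule order_trans[OF norm_sum]) (simp add: norm_mult norm_power)
      also have "\<dots> \<le> exp (norm \<beta> * norm v)"
        unfolding exp_def by (rule sum_le_suminf[OF summable_exp_generic]) auto
      finally have "norm (T m v) \<le> exp (norm \<beta> * norm v)" .
      moreover have "norm (e v) \<le> exp (- (\<sigma> * (norm v)\<^sup>2) + norm \<alpha> * norm v)"
        using abs_Re_le_cmod[of "\<alpha> * v"] by (simp add: e_def norm_mult)
      ultimately have "norm (e v) * norm (T m v) \<le>
          exp (- (\<sigma> * (norm v)\<^sup>2) + norm \<alpha> * norm v) * exp (norm \<beta> * norm v)"
        by (intro mult_mono) auto
      also have "\<dots> = exp ((norm \<alpha> + norm \<beta>) * norm v - \<sigma> * (norm v)\<^sup>2)"
        by (simp add: exp_add[symmetric] algebra_simps)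
      also have "\<dots> \<le> B"
        using exp_quadratic_power_bound[OF \<sigma>, of "norm v" "norm \<alpha> + norm \<beta>" 0] by (simp add: B_def)
      finally show ?thesis by (simp add: norm_mult q_def)
    qed
    have T_cont: "continuous_on UNIV (\<lambda>x. T m (w x))" for m
      unfolding T_def by (intro continuous_intros)
    have T0: "(LINT g|lborel. f g * (q g * e (w (fst g)) * T m (w (fst g)))) = 0" for m
    proof -
      have int: "integrable lborel (\<lambda>g. f g * (q g * e (w (fst g)) * cnj (w (fst g)) ^ n))" for n
      proof (rule integrable_mult_bounded[OF f])
        show "(\<lambda>g. q g * e (w (fst g)) * cnj (w (fst g)) ^ n) \<in> borel_measurable lborel"
          using q_meas[of "\<lambda>x. cnj (w x) ^ n"] by (simp add: continuous_intros)
        show "norm (q g * e (w (fst g)) * cnj (w (fst g)) ^ n) \<le> fact n * exp ((norm \<alpha> + 1)\<^sup>2 / (4 * \<sigma>))" for g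
          using norm_gaussian_power_le[OF \<sigma> order_refl, of "w (fst g)" \<alpha> n]
          by (simp add: q_def e_def norm_mult)
      qed
      have eq: "f g * (q g * e (w (fst g)) * T m (w (fst g))) =
          (\<Sum>n<m. \<beta> ^ n / fact n * (f g * (q g * e (w (fst g)) * cnj (w (fst g)) ^ n)))" for g
        unfolding T_def sum_distrib_left
        by (intro sum.cong refl) (simp add: power_mult_distrib scaleR_conv_of_real divide_inverse mult_ac)
      show ?thesis
        unfolding eq using int moments[of \<xi> \<alpha>] by (simp add: q_def e_def mult.assoc)
    qed
    have "(\<lambda>m. LINT g|lborel. f g * (q g * e (w (fst g)) * T m (w (fst g)))) \<longlonglongrightarrow>
        (LINT g|lborel. f g * (q g * e (w (fst g)) * exp (\<beta> * cnj (w (fst g)))))"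
    proof (rule integral_dominated_convergence[where w="\<lambda>g. B * norm (f g)"])
      have "(\<lambda>g. q g * e (w (fst g)) * exp (\<beta> * cnj (w (fst g)))) \<in> borel_measurable borel"
        by (rule q_meas[of "\<lambda>x. exp (\<beta> * cnj (w x))"]) (intro continuous_intros)
      then show "(\<lambda>g. f g * (q g * e (w (fst g)) * exp (\<beta> * cnj (w (fst g))))) \<in> borel_measurable lborel"
        by simp
      show "(\<lambda>g. f g * (q g * e (w (fst g)) * T m (w (fst g)))) \<in> borel_measurable lborel" for m
        using q_meas[OF T_cont[of m]] by simp
      show "integrable lborel (\<lambda>g. B * norm (f g))" using f by simp
      show "AE g in lborel. (\<lambda>m. f g * (q g * e (w (fst g)) * T m (w (fst g)))) \<longlonglongrightarrow>
          f g * (q g * e (w (fst g)) * exp (\<beta> * cnj (w (fst g))))"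
        using exp_converges unfolding T_def sums_def by (intro AE_I2 tendsto_intros) auto
      show "AE g in lborel. norm (f g * (q g * e (w (fst g)) * T m (w (fst g)))) \<le> B * norm (f g)" for m
        using T_bound unfolding norm_mult[of "f _"] mult.commute[of B]
        by (intro AE_I2 mult_left_mono) auto
    qed
    then have "(LINT g|lborel. f g * (q g * e (w (fst g)) * exp (\<beta> * cnj (w (fst g))))) = 0"
      using T0 by (simp add: LIMSEQ_const_iff)
    moreover have "f g * (q g * e (w (fst g)) * exp (\<beta> * cnj (w (fst g)))) = h g * cis (\<xi> \<bullet> fst g)" for g
    proof -
      have e: "e v * exp (\<beta> * cnj v) = exp (- of_real (\<sigma> * (norm v)\<^sup>2)) * cis (\<eta> \<bullet> v)" for v
        unfolding e_def exp_add[symmetric] add.assoc \<alpha>\<beta> cis_conv_exp ..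
      have "P x \<bullet> \<xi> = \<eta> \<bullet> w x" for x
        unfolding P_def \<eta>_def w_def plane_vec_inner[OF \<nu>0 \<omega>] by (simp add: inner_complex_def mult.commute)
      then have q: "q g * cis (\<eta> \<bullet> w (fst g)) = p g * cis (\<xi> \<bullet> fst g)"
        unfolding q_def p_def cis_mult by (simp add: inner_diff_right inner_commute algebra_simps)
      have "f g * (q g * e (w (fst g)) * exp (\<beta> * cnj (w (fst g)))) =
          f g * (q g * (e (w (fst g)) * exp (\<beta> * cnj (w (fst g)))))"
        by (simp only: mult.assoc)
      also have "\<dots> = f g * exp (- of_real (\<sigma> * (norm (w (fst g)))\<^sup>2)) * (q g * cis (\<eta> \<bullet> w (fst g)))"
        by (simp only: e mult_ac)
      also have "\<dots> = h g * cis (\<xi> \<bullet> fst g)"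
        unfolding q h_def by (simp only: mult_ac)
      finally show ?thesis .
    qed
    ultimately show ?thesis by simp
  qed
  \<comment> \<open>This growing test function is admissible because its product with
    \<open>h\<close> is \<open>f\<close> times a character, hence integrable.\<close>
  let ?G = "\<lambda>x. cis (\<xi> \<bullet> x - (J br \<mu> x \<bullet> P x) / 2) * exp (of_real (\<sigma> * (norm (w x))\<^sup>2))"
  have eq: "h g * ?G (fst g) = f g * cis (\<xi> \<bullet> fst g - \<mu> \<bullet> snd g)" for g
  proof -
    have "exp (- of_real t) * exp (of_real t) = (1::complex)" for t
      by (simp add: exp_add[symmetric])
    moreover have "p g * cis (\<xi> \<bullet> fst g - (J br \<mu> (fst g) \<bullet> P (fst g)) / 2) = cis (\<xi> \<bullet> fst g - \<mu> \<bullet> snd g)"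
      unfolding p_def cis_mult by simp
    ultimately have "f g * (p g * cis (\<xi> \<bullet> fst g - (J br \<mu> (fst g) \<bullet> P (fst g)) / 2)) *
        (exp (- of_real (\<sigma> * (norm (w (fst g)))\<^sup>2)) * exp (of_real (\<sigma> * (norm (w (fst g)))\<^sup>2))) =
        f g * cis (\<xi> \<bullet> fst g - \<mu> \<bullet> snd g)"
      by (simp only: mult_1_right)
    then show ?thesis
      unfolding h_def by (simp only: mult_ac)
  qed
  have "(LINT g|lborel. h g * ?G (fst g)) = 0"
  proof (rule fourier_uniqueness[OF h _ h0, where G="?G"])
    show "?G \<in> borel_measurable borel"
      by (intro borel_measurable_continuous_onI continuous_intros) auto
    have "(\<lambda>g::'v \<times> 'z. cis (\<xi> \<bullet> fst g - \<mu> \<bullet> snd g)) \<in> borel_measurable borel"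
      by (intro borel_measurable_continuous_onI continuous_intros)
    then show "integrable lborel (\<lambda>g. h g * ?G (fst g))"
      unfolding eq by (intro integrable_mult_unit[OF f]) auto
  qed simp
  then show ?thesis unfolding eq .
qed

end

section \<open>Injectivity\<close>

context h_type_group
begin

text \<open>Integration over a geodesic commutes with conjugation. Replacing \<open>f\<close> by its
  conjugate turns \<mu> into -\<mu> and so reaches the opposite half-space of characters.\<close>

lemma xray_zero_cnj:
  assumes "lam \<noteq> 0" "xray_zero br \<nu> lam f"
  shows "xray_zero br \<nu> lam (\<lambda>g. cnj (f g))"
proof -
  have "space (quot_measure br lam) = range (coset br lam)"
    by (simp add: quot_measure_def space_measure_of_conv)
  then have "AE C in quot_measure br lam. C \<in> range (coset br lam)"
    by (metis AE_space)
  then show ?thesis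
    using assms(2) unfolding xray_zero_def
    by eventually_elim (auto simp: xray_coset[OF assms(1)])
qed

text \<open>The Fourier transform of an integrable function is continuous; the central frequency is
  \<open>- \<mu>\<close> in this sign convention.\<close>

lemma AE_eq_0_if_fourier_eq_0_on_dense:
  fixes f :: "'v \<times> 'z \<Rightarrow> complex"
  assumes f: "integrable lborel f" and D: "closure D = UNIV"
    and zero: "\<And>\<mu> \<xi>. \<mu> \<in> D \<Longrightarrow> (LINT g|lborel. f g * cis (\<xi> \<bullet> fst g - \<mu> \<bullet> snd g)) = 0"
  shows "AE g in lborel. f g = 0"
proof (rule fourier_uniqueness_AE[OF f])
  fix p :: "'v \<times> 'z"
  have "- snd p \<in> closure D" using D by simp
  then obtain X where X: "\<And>n. X n \<in> D" "X \<longlonglongrightarrow> - snd p"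
    unfolding closure_sequential by auto
  have "(\<lambda>n. LINT g|lborel. f g * cis ((fst p, - X n) \<bullet> g)) \<longlonglongrightarrow> (LINT g|lborel. f g * cis ((fst p, - (- snd p)) \<bullet> g))"
    by (intro continuous_fourier f tendsto_intros X) simp
  moreover have "(LINT g|lborel. f g * cis ((fst p, - X n) \<bullet> g)) = 0" for n
    using zero[OF X(1), of "fst p"] by (simp add: inner_prod_def)
  ultimately show "(LINT g|lborel. f g * cis (p \<bullet> g)) = 0"
    by (simp add: LIMSEQ_const_iff)
qed

text \<open>By compactness of the spheres, a subsequence has convergent \<open>N n\<close> and
  convergent directions of \<open>l n\<close>. The open half-space \<mu> \<bullet> \<omega> > 0 is
  then covered directly, the opposite one by conjugation, and their union is dense.\<close>

lemma injective_if_accumulating: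
  assumes f: "integrable lborel f" and Z: "zero_set br f Z" "0 islimpt Z"
  shows "AE g in lborel. f g = 0"
proof -
  obtain l where l: "\<And>n::nat. l n \<in> Z - {0}" "l \<longlonglongrightarrow> 0"
    using Z(2) unfolding islimpt_sequential by auto
  have "\<exists>\<nu>. norm \<nu> = 1 \<and> xray_zero br \<nu> (l n) f" for n
    using Z(1) l(1)[of n] unfolding zero_set_def by fastforce
  then obtain N where N: "\<And>n. norm (N n) = 1" "\<And>n. xray_zero br (N n) (l n) f"
    by metis
  have compact: "seq_compact (sphere 0 1 \<times> sphere 0 1 :: ('v \<times> 'z) set)"
    by (intro compact_imp_seq_compact compact_Times compact_sphere)
  have "\<forall>n. (N n, sgn (l n)) \<in> sphere 0 1 \<times> sphere 0 1"
    using N(1) l(1) by (simp add: norm_sgn)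
  from seq_compactE[OF compact this] obtain p r where r: "strict_mono r" "((\<lambda>n. (N n, sgn (l n))) \<circ> r) \<longlonglongrightarrow> p"
    by blast
  define \<omega> where "\<omega> = snd p"
  have lim: "(\<lambda>n. N (r n)) \<longlonglongrightarrow> fst p" "(\<lambda>n. sgn (l (r n))) \<longlonglongrightarrow> \<omega>"
    using tendsto_fst[OF r(2)] tendsto_snd[OF r(2)] by (simp_all add: o_def \<omega>_def)
  have l0: "(\<lambda>n. l (r n)) \<longlonglongrightarrow> 0"
    using LIMSEQ_subseq_LIMSEQ[OF l(2) r(1)] by (simp add: o_def)
  have ne: "l (r n) \<noteq> 0" for n using l(1) by auto
  have \<omega>: "norm \<omega> = 1"
    using tendsto_norm[OF lim(2)] ne by (simp add: norm_sgn LIMSEQ_const_iff)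
  have pos: "(LINT g|lborel. f g * cis (\<xi> \<bullet> fst g - \<mu> \<bullet> snd g)) = 0" if "\<mu> \<bullet> \<omega> > 0" for \<mu> \<xi>
    using fourier_eq_0_if_accumulating[OF f ne l0 lim(2) N(1) lim(1) N(2) that] .
  have neg: "(LINT g|lborel. f g * cis (\<xi> \<bullet> fst g - \<mu> \<bullet> snd g)) = 0" if "\<mu> \<bullet> \<omega> < 0" for \<mu> \<xi>
  proof -
    have "integrable lborel (\<lambda>g. cnj (f g))" using f by simp
    from fourier_eq_0_if_accumulating[OF this ne l0 lim(2) N(1) lim(1) xray_zero_cnj[OF ne N(2)], of "- \<mu>" "- \<xi>"] that
    have "(LINT g|lborel. cnj (f g) * cis (- (\<xi> \<bullet> fst g - \<mu> \<bullet> snd g))) = 0" by simp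
    from complex_integral_cnj_eq_0[OF this] show ?thesis by simp
  qed
  have "closure {\<mu>. \<mu> \<bullet> \<omega> \<noteq> 0} = UNIV"
  proof -
    have "\<mu> \<in> closure {\<mu>. \<mu> \<bullet> \<omega> \<noteq> 0}" for \<mu>
    proof (cases "\<mu> \<bullet> \<omega> = 0")
      case True
      have "(\<lambda>n. \<mu> + inverse (real (Suc n)) *\<^sub>R \<omega>) \<longlonglongrightarrow> \<mu> + 0 *\<^sub>R \<omega>"
        by (intro tendsto_intros LIMSEQ_inverse_real_of_nat)
      moreover have "(\<mu> + inverse (real (Suc n)) *\<^sub>R \<omega>) \<bullet> \<omega> \<noteq> 0" for n
        using True \<omega> by (simp add: inner_add_left norm_eq_1)
      ultimately show ?thesis
        unfolding closure_sequential
        by (intro exI[of _ "\<lambda>n. \<mu> + inverse (real (Suc n)) *\<^sub>R \<omega>"]) auto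
    next
      case False
      then show ?thesis by (intro subsetD[OF closure_subset]) simp
    qed
    then show ?thesis by (intro equalityI subsetI UNIV_I)
  qed
  then show ?thesis
  proof (rule AE_eq_0_if_fourier_eq_0_on_dense[OF f])
    fix \<mu> \<xi> assume "\<mu> \<in> {\<mu>. \<mu> \<bullet> \<omega> \<noteq> 0}"
    then have "\<mu> \<bullet> \<omega> > 0 \<or> \<mu> \<bullet> \<omega> < 0" by auto
    then show "(LINT g|lborel. f g * cis (\<xi> \<bullet> fst g - \<mu> \<bullet> snd g)) = 0"
      by (elim disjE) (rule pos neg, assumption)+
  qed
qed

text \<open>The set of \<mu> orthogonal to some element of \<open>Z\<close> is invariant under
  scaling, so density of its unit vectors in the sphere makes it dense in the whole space.\<close>

lemma injective_if_dense_hyperplanes: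
  assumes f: "integrable lborel f" and Z: "zero_set br f Z" "dense_hyperplanes Z"
  shows "AE g in lborel. f g = 0"
proof -
  define D where "D = {\<mu>. \<exists>lam\<in>Z. \<mu> \<bullet> lam = 0}"
  have "\<mu> \<in> closure D" for \<mu>
  proof -
    obtain \<sigma> where \<sigma>: "norm \<sigma> = 1" "\<mu> = norm \<mu> *\<^sub>R \<sigma>"
    proof (cases "\<mu> = 0")
      case True
      then show ?thesis using that[of "SOME b. b \<in> Basis"] by (simp add: norm_some_Basis)
    next
      case False
      then show ?thesis using that[of "sgn \<mu>"] by (simp add: norm_sgn sgn_div_norm)
    qed
    then have "\<sigma> \<in> closure {\<mu> \<in> sphere 0 1. orthogonal_comp {\<mu>} \<inter> Z \<noteq> {}}"
      using Z(2) unfolding dense_hyperplanes_def by auto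
    then obtain X where X: "\<And>n. orthogonal_comp {X n} \<inter> Z \<noteq> {}" "X \<longlonglongrightarrow> \<sigma>"
      unfolding closure_sequential by auto
    have "norm \<mu> *\<^sub>R X n \<in> D" for n
      using X(1)[of n] by (auto simp: D_def orthogonal_comp_def orthogonal_def)
    moreover have "(\<lambda>n. norm \<mu> *\<^sub>R X n) \<longlonglongrightarrow> \<mu>"
      using tendsto_scaleR[OF tendsto_const X(2), of "norm \<mu>"] unfolding \<sigma>(2)[symmetric] .
    ultimately show ?thesis
      unfolding closure_sequential by (intro exI[of _ "\<lambda>n. norm \<mu> *\<^sub>R X n"]) auto
  qed
  then have "closure D = UNIV" by blast
  then show ?thesis
  proof (rule AE_eq_0_if_fourier_eq_0_on_dense[OF f])
    fix \<mu> \<xi> assume "\<mu> \<in> D"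
    then obtain lam where "lam \<in> Z" "\<mu> \<bullet> lam = 0" by (auto simp: D_def)
    moreover from this obtain \<nu> where "norm \<nu> = 1" "xray_zero br \<nu> lam f"
      using Z(1) unfolding zero_set_def by fastforce
    moreover have "lam \<noteq> 0" using Z(1) \<open>lam \<in> Z\<close> by (auto simp: zero_set_def)
    ultimately show "(LINT g|lborel. f g * cis (\<xi> \<bullet> fst g - \<mu> \<bullet> snd g)) = 0"
      using fourier_eq_0_if_orthogonal f by blast
  qed
qed

end

section \<open>Sphere measure and sets of full measure\<close>

lemma emeasure_lborel_ball_minus_zero:
  "r > 0 \<Longrightarrow> emeasure lborel (ball 0 r - {0::'a::euclidean_space}) = ennreal (unit_ball_vol DIM('a) * r ^ DIM('a))"
  by (subst emeasure_Diff_null_set) (simp_all add: emeasure_ball null_sets_def)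

lemma space_sphere_measure: "space sphere_measure = sphere (0::'v::euclidean_space) 1"
  by (simp add: sphere_measure_def space_scale_measure space_restrict_space)

lemma emeasure_sphere_measure:
  "emeasure sphere_measure (sphere (0::'v::euclidean_space) 1) = ennreal (DIM('v) * unit_ball_vol DIM('v))"
proof -
  have [measurable]: "(sgn :: 'v \<Rightarrow> 'v) \<in> borel_measurable borel"
    unfolding sgn_div_norm by measurable
  have "(sgn :: 'v \<Rightarrow> 'v) \<in> measurable (restrict_space lborel (ball 0 1 - {0})) (restrict_space borel (sphere 0 1))"
    by (intro measurable_restrict_space2 measurable_restrict_space1) (auto simp: space_restrict_space norm_sgn)
  moreover have "sphere (0::'v) 1 \<in> sets (restrict_space borel (sphere 0 1))"
    by (simp add: sets_restrict_space_iff)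
  moreover have "sgn -` sphere 0 1 \<inter> space (restrict_space lborel (ball 0 1 - {0::'v})) = ball 0 1 - {0}"
    by (auto simp: space_restrict_space norm_sgn)
  ultimately have "emeasure (distr (restrict_space lborel (ball 0 1 - {0})) (restrict_space borel (sphere 0 1)) sgn) (sphere (0::'v) 1) =
      ennreal (unit_ball_vol DIM('v))"
    using emeasure_lborel_ball_minus_zero[of 1, where 'a='v]
    by (simp add: emeasure_distr emeasure_restrict_space)
  then show ?thesis
    by (simp add: sphere_measure_def emeasure_scale_measure ennreal_mult ennreal_of_nat_eq_real_of_nat)
qed

lemma finite_measure_sphere_measure: "finite_measure sphere_measure"
  by (rule finite_measureI) (simp add: space_sphere_measure emeasure_sphere_measure)

text \<open>The sphere has positive measure, so a property that holds almost everywhere holds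
  somewhere.\<close>

lemma AE_sphere_measure_ex:
  assumes "AE \<nu> in (sphere_measure :: 'v::euclidean_space measure). Q \<nu>"
  shows "\<exists>\<nu>\<in>sphere 0 1. Q \<nu>"
proof -
  have "emeasure (sphere_measure :: 'v measure) (space sphere_measure) \<noteq> 0"
    by (simp add: space_sphere_measure emeasure_sphere_measure ennreal_eq_0_iff not_le)
  then have "ae_filter (sphere_measure :: 'v measure) \<noteq> bot"
    by (simp add: ae_filter_eq_bot_iff)
  moreover have "AE \<nu> in sphere_measure. \<nu> \<in> sphere 0 1 \<and> Q \<nu>"
    using assms AE_space[of sphere_measure] unfolding space_sphere_measure by eventually_elim auto
  ultimately show ?thesis
    using eventually_happens by blast
qed

text \<open>Punctured balls around 0 have positive measure and cannot lie in the exceptional null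
  set.\<close>

lemma islimpt_AE_lborel:
  assumes "AE x in lborel. Q (x :: 'a::euclidean_space)"
  shows "0 islimpt {x. Q x}"
proof -
  obtain N where N: "{x. \<not> Q x} \<subseteq> N" "emeasure lborel N = 0" "N \<in> sets lborel"
    using AE_E[OF assms] by auto
  have "\<exists>x\<in>ball 0 r. x \<noteq> 0 \<and> Q x" if "r > 0" for r
  proof (rule ccontr)
    assume "\<not> ?thesis"
    then have "ball 0 r - {0} \<subseteq> N" using N(1) by auto
    then have "emeasure lborel (ball 0 r - {0} :: 'a set) \<le> 0"
      using emeasure_mono[OF _ N(3)] N(2) by metis
    moreover have "unit_ball_vol (real DIM('a)) * r ^ DIM('a) > 0"
      using that by (intro mult_pos_pos) auto
    ultimately show False
      using that by (simp add: emeasure_lborel_ball_minus_zero ennreal_eq_0_iff)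
  qed
  then show ?thesis
    unfolding islimpt_approachable by (fastforce simp: dist_commute)
qed

text \<open>The hyperplane orthogonal to \<sigma> contains a point \<open>c\<close> of the great
  circle. Directions of \<open>Z\<close> near \<open>c\<close> are almost orthogonal to \<sigma>, so
  a small correction of \<sigma> makes it exactly orthogonal to an element of
  \<open>Z\<close>.\<close>

lemma dense_hyperplanes_if_great_circle:
  fixes Z :: "'z::euclidean_space set"
  assumes Z: "Z \<subseteq> - {0}" and C: "great_circle C" "C \<subseteq> closure (sgn ` Z)"
  shows "dense_hyperplanes Z"
  unfolding dense_hyperplanes_def
proof
  fix \<sigma> :: 'z assume "\<sigma> \<in> sphere 0 1"
  then have \<sigma>: "norm \<sigma> = 1" by simp
  obtain P where P: "subspace P" "dim P = 2" "C = sphere 0 1 \<inter> P"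
    using C(1) by (auto simp: great_circle_def)
  obtain c where c: "c \<in> C" "\<sigma> \<bullet> c = 0"
  proof -
    \<comment> \<open>A linear functional on a two-dimensional space has a nontrivial
      kernel.\<close>
    have "\<exists>v\<in>P. v \<noteq> 0 \<and> \<sigma> \<bullet> v = 0"
    proof (rule ccontr)
      assume no: "\<not> ?thesis"
      have lin: "linear (\<lambda>v. \<sigma> \<bullet> v)" by (simp add: linear_iff inner_add_right)
      have "inj_on (\<lambda>v. \<sigma> \<bullet> v) P"
        using no P(1) by (subst linear_inj_on_iff_eq_0[OF lin]) auto
      then have "dim ((\<lambda>v. \<sigma> \<bullet> v) ` P) = dim P"
        by (intro dim_image_eq[OF lin]) (simp add: span_eq_iff[THEN iffD2, OF P(1)])
      moreover have "dim ((\<lambda>v. \<sigma> \<bullet> v) ` P) \<le> 1"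
        using dim_subset_UNIV[of "(\<lambda>v. \<sigma> \<bullet> v) ` P"] by simp
      ultimately show False using P(2) by simp
    qed
    then obtain v where v: "v \<in> P" "v \<noteq> 0" "\<sigma> \<bullet> v = 0" by blast
    show ?thesis
      by (rule that[of "sgn v"]) (use v P in \<open>auto simp: norm_sgn sgn_div_norm subspace_scale\<close>)
  qed
  then have "c \<in> closure (sgn ` Z)" using C(2) by blast
  then obtain X where X: "\<And>n. X n \<in> sgn ` Z" "X \<longlonglongrightarrow> c"
    unfolding closure_sequential by auto
  \<comment> \<open>The projection of \<sigma> onto the hyperplane orthogonal to \<open>X n\<close>;
    it tends to \<sigma> because \<open>\<sigma> \<bullet> c = 0\<close>.\<close>
  define Y where "Y n = \<sigma> - (\<sigma> \<bullet> X n) *\<^sub>R X n" for n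
  have XX: "X n \<bullet> X n = 1" for n
    using X(1)[of n] Z by (auto simp: norm_eq_1[symmetric] norm_sgn)
  have "Y \<longlonglongrightarrow> \<sigma> - (\<sigma> \<bullet> c) *\<^sub>R c"
    unfolding Y_def by (intro tendsto_intros X)
  then have Y: "Y \<longlonglongrightarrow> \<sigma>" using c by simp
  then have sgnY: "(\<lambda>n. sgn (Y n)) \<longlonglongrightarrow> sgn \<sigma>"
    using \<sigma> by (intro tendsto_sgn) auto
  have "sgn \<sigma> = \<sigma>" using \<sigma> by (simp add: sgn_div_norm)
  have "\<forall>\<^sub>F n in sequentially. Y n \<noteq> 0"
    using Y \<sigma> by (intro tendsto_imp_eventually_ne) auto
  then have "\<forall>\<^sub>F n in sequentially. sgn (Y n) \<in> {\<mu> \<in> sphere 0 1. orthogonal_comp {\<mu>} \<inter> Z \<noteq> {}}"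
  proof eventually_elim
    case (elim n)
    obtain z where z: "z \<in> Z" "X n = sgn z" using X(1) by blast
    have "Y n \<bullet> X n = 0" using XX by (simp add: Y_def inner_diff_left)
    then have "z \<in> orthogonal_comp {sgn (Y n)}"
      using z Z by (auto simp: orthogonal_comp_def orthogonal_def sgn_div_norm)
    then show ?case using z elim by (auto simp: norm_sgn)
  qed
  then show "\<sigma> \<in> closure {\<mu> \<in> sphere 0 1. orthogonal_comp {\<mu>} \<inter> Z \<noteq> {}}"
    using sgnY unfolding \<open>sgn \<sigma> = \<sigma>\<close>
    by (intro Lim_in_closed_set[OF closed_closure, of "\<lambda>n. sgn (Y n)" _ sequentially])
      (auto elim!: eventually_mono intro: subsetD[OF closure_subset])
qed

theorem corollary2p4:
  fixes br :: "'v::euclidean_space \<times> 'z::euclidean_space \<Rightarrow> 'v \<times> 'z \<Rightarrow> 'v \<times> 'z"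
  assumes "H_type br"
  shows
    "(\<forall>f :: 'v \<times> 'z \<Rightarrow> complex.
        integrable lborel f \<longrightarrow>
        (AE (\<nu>, lam) in sphere_measure \<Otimes>\<^sub>M lborel. lam \<noteq> 0 \<longrightarrow> xray_zero br \<nu> lam f) \<longrightarrow>
        (AE g in lborel. f g = 0)) \<and>
     (\<forall>Z \<subseteq> - {0}.
        (\<exists>l :: nat \<Rightarrow> 'z. range l \<subseteq> Z \<and> 0 islimpt range l) \<or>
        (DIM('z) > 1 \<and> dense_hyperplanes Z) \<longrightarrow>
        injectivity_set br Z) \<and>
     (\<forall>Z :: 'z set. Z \<subseteq> - {0} \<longrightarrow>
        (\<exists>C. great_circle C \<and> C \<subseteq> closure (sgn ` Z)) \<longrightarrow>
        DIM('z) > 1 \<and> dense_hyperplanes Z)"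
proof -
  interpret h_type_group br
    by unfold_locales (rule assms)
  have "AE g in lborel. f g = 0"
    if f: "integrable lborel f"
      and z: "AE (\<nu>, lam) in sphere_measure \<Otimes>\<^sub>M lborel. lam \<noteq> 0 \<longrightarrow> xray_zero br \<nu> lam f" for f
  proof -
    interpret S: finite_measure "sphere_measure :: 'v measure"
      by (rule finite_measure_sphere_measure)
    interpret pair_sigma_finite "sphere_measure :: 'v measure" "lborel :: 'z measure" ..
    \<comment> \<open>Fubini provides a single \<nu> that works for almost every \<open>lam\<close>;
      these \<open>lam\<close> form a zero set accumulating at the origin.\<close>
    obtain \<nu> where \<nu>: "\<nu> \<in> sphere 0 1" "AE lam in lborel. lam \<noteq> 0 \<longrightarrow> xray_zero br \<nu> lam f"
      using AE_sphere_measure_ex[OF AE_pair[OF z]] by auto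
    have "0 islimpt {lam. lam \<noteq> 0 \<and> xray_zero br \<nu> lam f}"
      using islimpt_AE_lborel[OF \<nu>(2)] unfolding islimpt_approachable by simp metis
    moreover have "zero_set br f {lam. lam \<noteq> 0 \<and> xray_zero br \<nu> lam f}"
      using \<nu>(1) by (auto simp: zero_set_def)
    ultimately show ?thesis using injective_if_accumulating f by blast
  qed
  moreover have "injectivity_set br Z"
    if "Z \<subseteq> - {0}"
      and "(\<exists>l :: nat \<Rightarrow> 'z. range l \<subseteq> Z \<and> 0 islimpt range l) \<or> (DIM('z) > 1 \<and> dense_hyperplanes Z)" for Z
    using that injective_if_accumulating injective_if_dense_hyperplanes islimpt_subset
    unfolding injectivity_set_def by blast
  moreover have "DIM('z) > 1 \<and> dense_hyperplanes Z"
    if Z: "Z \<subseteq> - {0}" and C: "great_circle C" "C \<subseteq> closure (sgn ` Z)" for Z C :: "'z set"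
  proof -
    obtain P :: "'z set" where "dim P = 2" using C(1) by (auto simp: great_circle_def)
    then have "DIM('z) > 1" using dim_subset_UNIV[of P] by simp
    then show ?thesis using dense_hyperplanes_if_great_circle Z C by blast
  qed
  ultimately show ?thesis by blast
qed

end
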